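(* Let $p>3$ be a prime and $E$ a supersingular elliptic curve over $\mathbb{F}_{p^2}$. Suppose $\operatorname{End}(E)$ corresponds to a ternary quadratic form $F$ of discriminant $p$ under the Brandt--Sohn correspondence (i.e. $\operatorname{End}(E)\cong \operatorname{Clf}^0(F)$). Then $j(E)\in\mathbb{F}_p$ (equivalently $E$ is defined over $\mathbb{F}_p$ up to isomorphism) if and only if $F$ properly represents $2$, i.e. $F(v)=2$ for some $v\in\mathbb{Z}^3$ with coprime entries.
   Context: $B_{p,\infty}$ is the quaternion algebra over $\mathbb{Q}$ ramified exactly at $p$ and $\infty$; $\operatorname{End}(E)$ is a maximal order in it. Write a ternary form as $F(x,y,z)=2ax^2+2by^2+2cz^2+2uyz+2vxz+2wxy$ with $a,b,c,u,v,w\in\mathbb{Z}$; its discriminant is $4abc+uvw-au^2-bv^2-cw^2$ ($=\det$ of its symmetric matrix divided by $2$). Its even Clifford order $\operatorname{Clf}^0(F)$ is $\mathbb{Z}+\mathbb{Z}i+\mathbb{Z}j+\mathbb{Z}k$ with $i^2=ui-bc$, $j^2=vj-ac$, $k^2=wk-ab$, $jk=a\bar i=a(u-i)$, $ki=b\bar j=b(v-j)$, $ij=c\bar k=c(w-k)$ (and the remaining products determined by the standard involution). For discriminant $p$ this is a maximal order of $B_{p,\infty}$ (Brandt--Sohn correspondence: a bijection between equivalence classes of such forms and type classes of maximal orders). *)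

theory Defs
  imports "HOL-Computational_Algebra.Polynomial"
begin

datatype 'k point = Inf | Pt 'k 'k

fun on_curve :: "'k::field \<Rightarrow> 'k \<Rightarrow> 'k point \<Rightarrow> bool" where
  "on_curve A B Inf = True"
| "on_curve A B (Pt x y) = (y ^ 2 = x ^ 3 + A * x + B)"

definition nonsingular :: "'k::field \<Rightarrow> 'k \<Rightarrow> bool" where
  "nonsingular A B = (4 * A ^ 3 + 27 * B ^ 2 \<noteq> 0)"

text \<open>Chord-and-tangent group law (valid in characteristic not 2 or 3).\<close>
fun padd :: "'k::field \<Rightarrow> 'k point \<Rightarrow> 'k point \<Rightarrow> 'k point" where
  "padd A Inf P = P"
| "padd A (Pt x1 y1) Inf = Pt x1 y1"
| "padd A (Pt x1 y1) (Pt x2 y2) =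
     (if x1 = x2 \<and> y1 = - y2 then Inf
      else (let l = (if x1 = x2 then (3 * x1 ^ 2 + A) / (2 * y1)
                     else (y2 - y1) / (x2 - x1));
                x3 = l ^ 2 - x1 - x2;
                y3 = l * (x1 - x3) - y1
            in Pt x3 y3))"

fun pmul :: "'k::field \<Rightarrow> nat \<Rightarrow> 'k point \<Rightarrow> 'k point" where
  "pmul A 0 P = Inf"
| "pmul A (Suc n) P = padd A P (pmul A n P)"

definition j_inv :: "'k::field \<Rightarrow> 'k \<Rightarrow> 'k" where
  "j_inv A B = 1728 * (4 * A ^ 3) / (4 * A ^ 3 + 27 * B ^ 2)"

text \<open>Supersingular: no nontrivial p-torsion over the algebraically closed field.\<close>
definition supersingular :: "nat \<Rightarrow> 'k::field \<Rightarrow> 'k \<Rightarrow> bool" where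
  "supersingular p A B = (\<forall>P. on_curve A B P \<and> pmul A p P = Inf \<longrightarrow> P = Inf)"

text \<open>Endomorphisms (over the algebraically closed field): maps of the point set that
  are group homomorphisms and agree, outside a finite set, with a rational map
  (x,y) |-> ((a1(x)+b1(x)y)/c1(x), (a2(x)+b2(x)y)/c2(x)) (every element of the function
  field of E has this shape), or are the zero map.  Maps are normalised to send
  non-curve points to Inf, so equality of endomorphisms is plain equality.\<close>
definition is_endo :: "'k::field \<Rightarrow> 'k \<Rightarrow> ('k point \<Rightarrow> 'k point) \<Rightarrow> bool" where
  "is_endo A B \<phi> =
    ((\<forall>P. \<not> on_curve A B P \<longrightarrow> \<phi> P = Inf)
     \<and> (\<forall>P. on_curve A B P \<longrightarrow> on_curve A B (\<phi> P))
     \<and> (\<forall>P Q. on_curve A B P \<and> on_curve A B Q \<longrightarrow> \<phi> (padd A P Q) = padd A (\<phi> P) (\<phi> Q))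
     \<and> ((\<forall>P. \<phi> P = Inf) \<or>
        (\<exists>a1 b1 c1 a2 b2 c2 :: 'k poly. c1 \<noteq> 0 \<and> c2 \<noteq> 0 \<and>
           finite {(x, y). on_curve A B (Pt x y) \<and>
              \<not> (poly c1 x \<noteq> 0 \<and> poly c2 x \<noteq> 0 \<and>
                 \<phi> (Pt x y) = Pt ((poly a1 x + poly b1 x * y) / poly c1 x)
                                  ((poly a2 x + poly b2 x * y) / poly c2 x))})))"

definition End_set :: "'k::field \<Rightarrow> 'k \<Rightarrow> ('k point \<Rightarrow> 'k point) set" where
  "End_set A B = {\<phi>. is_endo A B \<phi>}"

definition end_add :: "'k::field \<Rightarrow> 'k \<Rightarrow> ('k point \<Rightarrow> 'k point) \<Rightarrow> ('k point \<Rightarrow> 'k point) \<Rightarrow> 'k point \<Rightarrow> 'k point" where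
  "end_add A B \<phi> \<psi> = (\<lambda>P. if on_curve A B P then padd A (\<phi> P) (\<psi> P) else Inf)"

definition end_one :: "'k::field \<Rightarrow> 'k \<Rightarrow> 'k point \<Rightarrow> 'k point" where
  "end_one A B = (\<lambda>P. if on_curve A B P then P else Inf)"

type_synonym tform = "int \<times> int \<times> int \<times> int \<times> int \<times> int"

fun form_eval :: "tform \<Rightarrow> int \<Rightarrow> int \<Rightarrow> int \<Rightarrow> int" where
  "form_eval (a, b, c, u, v, w) x y z =
     2*a*x^2 + 2*b*y^2 + 2*c*z^2 + 2*u*y*z + 2*v*x*z + 2*w*x*y"

fun form_disc :: "tform \<Rightarrow> int" where
  "form_disc (a, b, c, u, v, w) = 4*a*b*c + u*v*w - a*u^2 - b*v^2 - c*w^2"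

definition properly_represents :: "tform \<Rightarrow> int \<Rightarrow> bool" where
  "properly_represents F n = (\<exists>x y z. gcd (gcd x y) z = 1 \<and> form_eval F x y z = n)"

text \<open>Elements of Clf^0(F): (t,x,y,z) stands for t + x i + y j + z k.\<close>
type_synonym q4 = "int \<times> int \<times> int \<times> int"

fun q_add :: "q4 \<Rightarrow> q4 \<Rightarrow> q4" where
  "q_add (t1, x1, y1, z1) (t2, x2, y2, z2) = (t1 + t2, x1 + x2, y1 + y2, z1 + z2)"

fun q_smul :: "int \<Rightarrow> q4 \<Rightarrow> q4" where
  "q_smul s (t, x, y, z) = (s * t, s * x, s * y, s * z)"

fun basis_vec :: "nat \<Rightarrow> q4" where
  "basis_vec n = (if n = 0 then (1,0,0,0) else if n = 1 then (0,1,0,0)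
                  else if n = 2 then (0,0,1,0) else (0,0,0,1))"

fun clf_basis_mul :: "tform \<Rightarrow> nat \<Rightarrow> nat \<Rightarrow> q4" where
  "clf_basis_mul (a, b, c, u, v, w) m n =
    (if m = 0 then basis_vec n else if n = 0 then basis_vec m
     else if m = 1 \<and> n = 1 then (-b*c, u, 0, 0)
     else if m = 2 \<and> n = 2 then (-a*c, 0, v, 0)
     else if m = 3 \<and> n = 3 then (-a*b, 0, 0, w)
     else if m = 2 \<and> n = 3 then (a*u, -a, 0, 0)
     else if m = 3 \<and> n = 1 then (b*v, 0, -b, 0)
     else if m = 1 \<and> n = 2 then (c*w, 0, 0, -c)
     else if m = 3 \<and> n = 2 then (-v*w, a, w, v)
     else if m = 1 \<and> n = 3 then (-u*w, w, b, u)
     else (-u*v, v, u, c))"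

fun q_coeff :: "q4 \<Rightarrow> nat \<Rightarrow> int" where
  "q_coeff (t, x, y, z) n = (if n = 0 then t else if n = 1 then x else if n = 2 then y else z)"

definition clf_mul :: "tform \<Rightarrow> q4 \<Rightarrow> q4 \<Rightarrow> q4" where
  "clf_mul F q r =
     foldr q_add [q_smul (q_coeff q m * q_coeff r n) (clf_basis_mul F m n).
                  m \<leftarrow> [0,1,2,3], n \<leftarrow> [0,1,2,3]] (0,0,0,0)"

definition clf_end_iso :: "tform \<Rightarrow> 'k::field \<Rightarrow> 'k \<Rightarrow> (q4 \<Rightarrow> 'k point \<Rightarrow> 'k point) \<Rightarrow> bool" where
  "clf_end_iso F A B h =
    (bij_betw h UNIV (End_set A B)
     \<and> h (1, 0, 0, 0) = end_one A B
     \<and> (\<forall>q r. h (q_add q r) = end_add A B (h q) (h r))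
     \<and> (\<forall>q r. h (clf_mul F q r) = h q \<circ> h r))"

end

(* The degree of the x-coordinate map, as a rational function, is a multiplicative function on
   End(E).  It satisfies the parallelogram law, because the x-coordinates of P + Q and P - Q are the
   roots of a quadratic whose coefficients are bihomogeneous and without common zero in x(P), x(Q);
   hence deg n = n^2.  An element q with trivial kernel and degree p has x-coordinate map a x^p, since
   an injective rational function of degree greater than 1 has vanishing derivative, and since q
   commutes with doubling, a^2 A^p = A and a^3 B^p = B, which is solvable in a iff j(E)^p = j(E).

   If F represents 2, multiplication by the odd central element of the Clifford algebra turns the
   representing vector into q with q^2 = -p; so deg q = p, and q has trivial kernel as E is
   supersingular.  Conversely, if j(E)^p = j(E), a twisted Frobenius map q of degree p is an
   endomorphism.  Comparing the quadratic form deg with the relation q^2 = T q - N on Z[q] forces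
   N = p and T^2 <= 4 p.  The conjugate T - q also has degree p and trivial kernel, so it is a unit
   times q; taking degrees, p divides T^2, so T = 0, and then the adjoint of the matrix of F carries
   the vector part of q to 2p times a vector representing 2. *)
theory Submission
  imports Defs "HOL-Computational_Algebra.Primes" "HOL-Library.Product_Plus"
begin

section \<open>Homogenised composition and primitive triples of polynomials\<close>

text \<open>An endomorphism is here only a map of points with rational formulas off a finite set, so
  its degree, its separability and its behaviour at infinity must be recovered. Passing to
  x-coordinates turns it into a rational function of one variable and loses only a sign. Degrees can
  be compared only if nothing cancels: the coefficients of the quadratic for P + Q and P - Q,
  computed in two ways, form two triples without common roots, so the factor between them is a
  constant. Bounds on degrees become equalities only once infinity is known to be fixed; for this,
  top coefficients are carried along with the bounds. A second obstacle: the isomorphism with the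
  Clifford order is a bare ring isomorphism, and nothing says in advance that Clifford conjugation
  is the dual isogeny or that the Clifford norm is the degree. For the Frobenius element q the
  agreement is deduced from three products in Z[q] whose degrees are evaluated in two ways. Sums of
  endomorphisms are computed in Z^4 through the isomorphism.\<close>

lemma coeff_mult_le_degrees:
  fixes p q :: "'a::comm_semiring_0 poly"
  assumes "degree p \<le> m" "degree q \<le> n"
  shows "coeff (p * q) (m + n) = coeff p m * coeff q n"
proof -
  have "coeff (p * q) (m + n) = (\<Sum>i\<le>m+n. coeff p i * coeff q (m + n - i))"
    by (simp add: coeff_mult)
  also have "\<dots> = (\<Sum>i\<le>m+n. if i = m then coeff p m * coeff q n else 0)"
  proof (rule sum.cong[OF refl])
    fix i assume "i \<in> {..m+n}"
    show "coeff p i * coeff q (m + n - i) = (if i = m then coeff p m * coeff q n else 0)"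
    proof (cases i m rule: linorder_cases)
      case less
      then have "degree q < m + n - i" using assms by linarith
      then show ?thesis using less by (simp add: coeff_eq_0)
    next
      case greater
      then have "degree p < i" using assms by linarith
      then show ?thesis using greater by (simp add: coeff_eq_0)
    qed simp
  qed
  also have "\<dots> = coeff p m * coeff q n" by (simp add: sum.delta)
  finally show ?thesis .
qed

lemma degree_mult_le_bounds:
  fixes p q :: "'a::comm_semiring_0 poly"
  assumes "degree p \<le> m" "degree q \<le> n"
  shows "degree (p * q) \<le> m + n"
  using degree_mult_le[of p q] assms by linarith

lemma coeff_power_le_degree:
  fixes p :: "'a::comm_semiring_1 poly"
  assumes "degree p \<le> m"
  shows "degree (p ^ n) \<le> n * m \<and> coeff (p ^ n) (n * m) = coeff p m ^ n"
proof (induction n)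
  case (Suc n)
  then show ?case
    using coeff_mult_le_degrees[OF assms, of "p ^ n" "n * m"] degree_mult_le_bounds[OF assms, of "p ^ n" "n * m"]
    by simp
qed simp

text \<open>The homogenisation of \<open>f\<close> in degree \<open>n\<close>, at
  \<open>(a : b)\<close>. The bound \<open>n\<close> is kept apart from \<open>degree f\<close>, so
  that two polynomials of unequal degree can form one map of the projective line.\<close>

definition heval :: "nat \<Rightarrow> 'a::comm_semiring_1 poly \<Rightarrow> 'a \<Rightarrow> 'a \<Rightarrow> 'a" where
  "heval n f a b = (\<Sum>i\<le>n. coeff f i * a ^ i * b ^ (n - i))"

definition hcomp :: "nat \<Rightarrow> 'a::comm_semiring_1 poly \<Rightarrow> 'a poly \<Rightarrow> 'a poly \<Rightarrow> 'a poly" where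
  "hcomp n f u v = (\<Sum>i\<le>n. smult (coeff f i) (u ^ i * v ^ (n - i)))"

lemma poly_hcomp: "poly (hcomp n f u v) x = heval n f (poly u x) (poly v x)"
  by (simp add: hcomp_def heval_def poly_sum mult_ac)

lemma heval_zero_right: "heval n f a 0 = coeff f n * a ^ n"
proof -
  have "heval n f a 0 = (\<Sum>i\<le>n. if i = n then coeff f n * a ^ n else 0)"
    unfolding heval_def by (intro sum.cong) (auto simp: zero_power)
  then show ?thesis by simp
qed

lemma heval_mult:
  assumes "degree f \<le> n"
  shows "heval n f (x * b) b = b ^ n * poly f x"
proof -
  have "poly f x = (\<Sum>i\<le>n. coeff f i * x ^ i)"
    unfolding poly_altdef
    by (rule sum.mono_neutral_left) (use assms in \<open>auto simp: coeff_eq_0\<close>)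
  then have "b ^ n * poly f x = (\<Sum>i\<le>n. b ^ n * (coeff f i * x ^ i))"
    by (simp add: sum_distrib_left)
  also have "\<dots> = heval n f (x * b) b"
    unfolding heval_def
  proof (rule sum.cong[OF refl])
    fix i assume "i \<in> {..n}"
    then have "b ^ n = b ^ i * b ^ (n - i)" by (simp flip: power_add)
    then show "b ^ n * (coeff f i * x ^ i) = coeff f i * (x * b) ^ i * b ^ (n - i)"
      by (simp add: power_mult_distrib mult_ac)
  qed
  finally show ?thesis by simp
qed

lemma hcomp_degree_coeff:
  assumes "degree u \<le> m" "degree v \<le> m"
  shows "degree (hcomp n f u v) \<le> n * m"
    and "coeff (hcomp n f u v) (n * m) = heval n f (coeff u m) (coeff v m)"
proof -
  have *: "degree (u ^ i * v ^ (n - i)) \<le> n * m \<and>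
      coeff (u ^ i * v ^ (n - i)) (n * m) = coeff u m ^ i * coeff v m ^ (n - i)" if "i \<le> n" for i
  proof -
    have "i * m + (n - i) * m = n * m" using that by (simp flip: add_mult_distrib)
    then show ?thesis
      using coeff_power_le_degree[OF assms(1), of i] coeff_power_le_degree[OF assms(2), of "n - i"]
        coeff_mult_le_degrees[of "u ^ i" "i * m" "v ^ (n - i)" "(n - i) * m"]
        degree_mult_le_bounds[of "u ^ i" "i * m" "v ^ (n - i)" "(n - i) * m"]
      by simp
  qed
  show "degree (hcomp n f u v) \<le> n * m"
    unfolding hcomp_def
    by (rule degree_sum_le) (use * order_trans[OF degree_smult_le] in auto)
  show "coeff (hcomp n f u v) (n * m) = heval n f (coeff u m) (coeff v m)"
    unfolding hcomp_def heval_def coeff_sum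
    by (intro sum.cong) (use * in \<open>auto simp: mult_ac\<close>)
qed

text \<open>For \<open>b \<noteq> 0\<close> a common zero would be a common root at
  \<open>a / b\<close>; the hypothesis \<open>top\<close> excludes the remaining point
  \<open>(1 : 0)\<close>.\<close>

lemma heval_no_common_zero:
  fixes f g :: "'a::field poly"
  assumes nz: "\<And>x. poly f x \<noteq> 0 \<or> poly g x \<noteq> 0" and "degree f \<le> n" "degree g \<le> n"
    and top: "coeff f n \<noteq> 0 \<or> coeff g n \<noteq> 0" and ab: "a \<noteq> 0 \<or> b \<noteq> 0"
  shows "heval n f a b \<noteq> 0 \<or> heval n g a b \<noteq> 0"
proof (cases "b = 0")
  case True
  then show ?thesis using top ab by (simp add: heval_zero_right)
next
  case False
  then have "heval n f a b = b ^ n * poly f (a / b)" "heval n g a b = b ^ n * poly g (a / b)"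
    using heval_mult[OF assms(2), of "a / b" b] heval_mult[OF assms(3), of "a / b" b] by simp_all
  then show ?thesis using False nz[of "a / b"] by simp
qed

text \<open>A nonzero element of least degree in the ideal of the three divides each of them; a root
  of it would be a common root, so over an algebraically closed field it is constant.\<close>

lemma poly_bezout_three:
  fixes a b c :: "'a::alg_closed_field poly"
  assumes nz: "\<And>x. poly a x \<noteq> 0 \<or> poly b x \<noteq> 0 \<or> poly c x \<noteq> 0"
  shows "\<exists>u v w. u * a + v * b + w * c = 1"
proof -
  define I where "I = {d. \<exists>u v w. d = u * a + v * b + w * c}"
  have I_a: "a \<in> I" unfolding I_def by (intro CollectI exI[of _ 1] exI[of _ 0]) simp
  have I_b: "b \<in> I" unfolding I_def by (rule CollectI, rule exI[of _ 0], rule exI[of _ 1], rule exI[of _ 0]) simp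
  have I_c: "c \<in> I" unfolding I_def by (rule CollectI, rule exI[of _ 0], rule exI[of _ 0], rule exI[of _ 1]) simp
  have I_diff: "d - q * e \<in> I" if dI: "d \<in> I" and eI: "e \<in> I" for d e q
  proof -
    obtain u v w where "d = u * a + v * b + w * c" using dI unfolding I_def by blast
    moreover obtain u' v' w' where "e = u' * a + v' * b + w' * c" using eI unfolding I_def by blast
    ultimately have "d - q * e = (u * a + v * b + w * c) - q * (u' * a + v' * b + w' * c)"
      by (simp only:)
    also have "\<dots> = (u - q * u') * a + (v - q * v') * b + (w - q * w') * c"
      by algebra
    finally have "d - q * e = (u - q * u') * a + (v - q * v') * b + (w - q * w') * c" .
    then show ?thesis unfolding I_def by - (rule CollectI, rule exI, rule exI, rule exI, assumption)
  qed
  have "a \<noteq> 0 \<or> b \<noteq> 0 \<or> c \<noteq> 0" using nz[of 0] by auto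
  then have "\<exists>d. d \<in> I \<and> d \<noteq> 0" using I_a I_b I_c by blast
  then obtain d where d: "d \<in> I" "d \<noteq> 0" and min: "\<And>e. e \<in> I \<Longrightarrow> e \<noteq> 0 \<Longrightarrow> degree d \<le> degree e"
    using ex_has_least_nat[of "\<lambda>d. d \<in> I \<and> d \<noteq> 0" _ degree] by blast
  have dvd: "d dvd e" if "e \<in> I" for e
  proof (rule ccontr)
    assume "\<not> d dvd e"
    then have nz: "e mod d \<noteq> 0" by (simp add: mod_eq_0_iff_dvd)
    have "e mod d = e - (e div d) * d" by (simp add: minus_div_mult_eq_mod)
    then have "e mod d \<in> I" using I_diff[OF that d(1)] by simp
    then have "degree d \<le> degree (e mod d)" using min nz by blast
    moreover have "degree (e mod d) < degree d"
      using degree_mod_less[OF d(2), of e] nz by blast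
    ultimately show False by simp
  qed
  have "degree d = 0"
  proof (rule ccontr)
    assume "degree d \<noteq> 0"
    then obtain x where "poly d x = 0" using alg_closed_imp_poly_has_root by blast
    then have "poly a x = 0 \<and> poly b x = 0 \<and> poly c x = 0"
      using dvd[OF I_a] dvd[OF I_b] dvd[OF I_c] by (auto simp: dvd_def)
    then show False using nz by blast
  qed
  then obtain k where k: "d = [:k:]" using degree_eq_zeroE by blast
  obtain u v w where uvw: "d = u * a + v * b + w * c" using d(1) unfolding I_def by blast
  have "k \<noteq> 0" using k d by simp
  then have "1 = smult (inverse k) d" using k by (simp add: one_pCons)
  also have "smult (inverse k) d = smult (inverse k) u * a + smult (inverse k) v * b + smult (inverse k) w * c"
    unfolding uvw smult_add_right mult_smult_left ..
  finally have "smult (inverse k) u * a + smult (inverse k) v * b + smult (inverse k) w * c = 1"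
    by (rule sym)
  then show ?thesis by - (rule exI, rule exI, rule exI, assumption)
qed

text \<open>The Bezout coefficients of one triple, applied to the other, produce the proportionality
  factor as a polynomial. Doing this in both directions also produces its inverse, so the factor is
  a unit, hence a constant.\<close>

lemma proportional_primitive_triples:
  fixes a b c a' b' c' :: "'a::alg_closed_field poly"
  assumes nz: "\<And>x. poly a x \<noteq> 0 \<or> poly b x \<noteq> 0 \<or> poly c x \<noteq> 0"
    and nz': "\<And>x. poly a' x \<noteq> 0 \<or> poly b' x \<noteq> 0 \<or> poly c' x \<noteq> 0"
    and eq: "a * b' = b * a'" "a * c' = c * a'" "b * c' = c * b'"
  shows "\<exists>k. k \<noteq> 0 \<and> a = smult k a' \<and> b = smult k b' \<and> c = smult k c'"
proof -
  obtain u v w where uvw: "u * a + v * b + w * c = 1" using poly_bezout_three[OF nz] by blast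
  obtain u' v' w' where uvw': "u' * a' + v' * b' + w' * c' = 1" using poly_bezout_three[OF nz'] by blast
  define m where "m = u * a' + v * b' + w * c'"
  define m' where "m' = u' * a + v' * b + w' * c"
  have A: "a = m' * a'" "b = m' * b'" "c = m' * c'"
  proof -
    have "a = a * (u' * a' + v' * b' + w' * c')" using uvw' by simp
    also have "\<dots> = u' * a * a' + v' * (a * b') + w' * (a * c')" by (simp add: algebra_simps)
    also have "\<dots> = m' * a'" unfolding eq m'_def by (simp add: algebra_simps)
    finally show "a = m' * a'" .
    have "b = b * (u' * a' + v' * b' + w' * c')" using uvw' by simp
    also have "\<dots> = u' * (b * a') + v' * b * b' + w' * (b * c')" by (simp add: algebra_simps)
    also have "\<dots> = m' * b'" unfolding eq(3) eq(1)[symmetric] m'_def by (simp add: algebra_simps)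
    finally show "b = m' * b'" .
    have "c = c * (u' * a' + v' * b' + w' * c')" using uvw' by simp
    also have "\<dots> = u' * (c * a') + v' * (c * b') + w' * c * c'" by (simp add: algebra_simps)
    also have "\<dots> = m' * c'" unfolding eq(2,3)[symmetric] m'_def by (simp add: algebra_simps)
    finally show "c = m' * c'" .
  qed
  have "m' * m = u * (m' * a') + v * (m' * b') + w * (m' * c')"
    unfolding m_def by (simp add: algebra_simps)
  then have "1 = m' * m" using uvw A by metis
  then have "m' dvd 1" by (rule dvdI)
  then obtain k where k: "m' = [:k:]" "k dvd 1"
    unfolding is_unit_poly_iff by blast
  then have "k \<noteq> 0" by auto
  have "m' * q = smult k q" for q by (simp add: k(1))
  then show ?thesis using A \<open>k \<noteq> 0\<close> by metis
qed

lemma poly_eqI_infinite: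
  fixes f g :: "'a::field poly"
  assumes "infinite {x. poly f x = poly g x}"
  shows "f = g"
proof -
  have "infinite {x. poly (f - g) x = 0}" using assms by simp
  then show ?thesis using poly_roots_finite[of "f - g"] by auto
qed

text \<open>Over a finite field the product of all linear factors \<open>[:- a, 1:]\<close>, plus 1,
  would be a nonconstant polynomial without roots.\<close>

lemma alg_closed_infinite: "infinite (UNIV :: 'a::alg_closed_field set)"
proof
  assume fin: "finite (UNIV :: 'a set)"
  define f :: "'a poly" where "f = (\<Prod>a\<in>UNIV. [:- a, 1:]) + 1"
  have "poly f x = 1" for x
    using fin by (simp add: f_def poly_prod prod_zero_iff)
  moreover have "degree f > 0"
  proof -
    have "degree (\<Prod>a\<in>(UNIV :: 'a set). [:- a, 1:]) = card (UNIV :: 'a set)"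
      by (subst degree_prod_sum_eq) auto
    moreover have "card (UNIV :: 'a set) > 0" using fin by (simp add: card_gt_0_iff)
    ultimately show ?thesis by (simp add: f_def degree_add_eq_left)
  qed
  ultimately show False using alg_closed_imp_poly_has_root[of f] by simp
qed

section \<open>The x-coordinates of sums and differences of points\<close>

text \<open>For P and Q with x-coordinates \<open>f1 / g1\<close> and \<open>f2 / g2\<close>, the
  quotients of \<open>triple_sum\<close> and \<open>triple_prod\<close> by \<open>triple_den\<close>
  are the sum and the product of x(P + Q) and x(P - Q). Stated over a commutative ring, the
  expressions serve field elements and polynomials alike.\<close>

definition triple_den :: "'a::comm_ring_1 \<Rightarrow> 'a \<Rightarrow> 'a \<Rightarrow> 'a \<Rightarrow> 'a" where
  "triple_den f1 g1 f2 g2 = (f1 * g2 - f2 * g1) ^ 2"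

definition triple_sum :: "'a::comm_ring_1 \<Rightarrow> 'a \<Rightarrow> 'a \<Rightarrow> 'a \<Rightarrow> 'a \<Rightarrow> 'a \<Rightarrow> 'a" where
  "triple_sum A B f1 g1 f2 g2 =
     2 * ((f1 * g2 + f2 * g1) * (f1 * f2 + A * g1 * g2) + 2 * B * g1 ^ 2 * g2 ^ 2)"

definition triple_prod :: "'a::comm_ring_1 \<Rightarrow> 'a \<Rightarrow> 'a \<Rightarrow> 'a \<Rightarrow> 'a \<Rightarrow> 'a \<Rightarrow> 'a" where
  "triple_prod A B f1 g1 f2 g2 =
     (f1 * f2 - A * g1 * g2) ^ 2 - 4 * B * (f1 * g2 + f2 * g1) * g1 * g2"

fun pneg :: "'k::field point \<Rightarrow> 'k point" where
  "pneg Inf = Inf"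
| "pneg (Pt x y) = Pt x (- y)"

lemma pneg_pneg [simp]: "pneg (pneg P) = P"
  by (cases P) auto

lemma on_curve_pneg [simp]: "on_curve A B (pneg P) = on_curve A B P"
  by (cases P) auto

lemma padd_Inf_right [simp]: "padd A P Inf = P"
  by (cases P) auto

lemma padd_pneg [simp]: "padd A P (pneg P) = Inf"
  by (cases P) auto

lemma padd_eq_Inf_iff: "padd A P Q = Inf \<longleftrightarrow> Q = pneg P"
  by (cases P; cases Q) (auto simp: Let_def)

text \<open>\<open>has_x P a b\<close>: the x-coordinate of \<open>P\<close> is the point \<open>(a : b)\<close> of the projective line.\<close>

fun has_x :: "'k::field point \<Rightarrow> 'k \<Rightarrow> 'k \<Rightarrow> bool" where
  "has_x Inf a b = (b = 0)"
| "has_x (Pt X Y) a b = (a = X * b)"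

lemma has_x_pneg [simp]: "has_x (pneg P) a b = has_x P a b"
  by (cases P) auto

fun x_rep :: "'k::field point \<Rightarrow> 'k \<times> 'k" where
  "x_rep Inf = (1, 0)"
| "x_rep (Pt X Y) = (X, 1)"

lemma has_x_scale:
  assumes "has_x P a b" "a \<noteq> 0 \<or> b \<noteq> 0"
  shows "\<exists>s. s \<noteq> 0 \<and> a = s * fst (x_rep P) \<and> b = s * snd (x_rep P)"
proof (cases P)
  case Inf
  then show ?thesis using assms by (intro exI[of _ a]) auto
next
  case (Pt X Y)
  then show ?thesis using assms by (intro exI[of _ b]) auto
qed

lemma has_x_eqD:
  assumes "has_x P a b" "has_x Q a b" "a \<noteq> 0 \<or> b \<noteq> 0" "on_curve A B P" "on_curve A B Q"
  shows "P = Q \<or> P = pneg Q"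
proof (cases P; cases Q)
  fix X Y X' Y' assume PQ: "P = Pt X Y" "Q = Pt X' Y'"
  with assms have "b \<noteq> 0" by auto
  then have "X = X'" using assms PQ by auto
  then have "Y ^ 2 = Y' ^ 2" using assms PQ by simp
  then show ?thesis using PQ \<open>X = X'\<close> by (auto simp: power2_eq_iff)
qed (use assms in auto)

locale elliptic =
  fixes A B :: "'k::alg_closed_field"
  assumes nonsing: "4 * A ^ 3 + 27 * B ^ 2 \<noteq> 0" and two_nz: "(2::'k) \<noteq> 0" and three_nz: "(3::'k) \<noteq> 0"
begin

lemma four_nz: "(4::'k) \<noteq> 0"
proof -
  have "(2::'k) * 2 \<noteq> 0" using two_nz unfolding mult_eq_0_iff by blast
  then show ?thesis by simp
qed

lemma no_root_cubic_and_doubling: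
  assumes "X ^ 3 + A * X + B = 0"
  shows "X ^ 4 - 2 * A * X ^ 2 - 8 * B * X + A ^ 2 \<noteq> 0"
proof
  assume "X ^ 4 - 2 * A * X ^ 2 - 8 * B * X + A ^ 2 = 0"
  \<comment> \<open>An explicit Bezout identity: the discriminant lies in the ideal generated by the
    numerator of x(2P) and the cubic, which is its denominator up to the factor 4.\<close>
  moreover have "4 * A ^ 3 + 27 * B ^ 2 =
     (3 * X ^ 2 + 4 * A) * (X ^ 4 - 2 * A * X ^ 2 - 8 * B * X + A ^ 2)
     - (3 * X ^ 3 - 5 * A * X - 27 * B) * (X ^ 3 + A * X + B)"
    by algebra
  ultimately show False using assms nonsing by simp
qed

lemma cubic_roots_simple:
  assumes "X ^ 3 + A * X + B = 0"
  shows "3 * X ^ 2 + A \<noteq> 0"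
proof
  assume "3 * X ^ 2 + A = 0"
  then have "4 * A ^ 3 + 27 * B ^ 2 = 0" using assms by algebra
  then show False using nonsing by simp
qed

text \<open>If \<open>triple_den\<close> vanishes, the two x-coordinates agree. When both are
  infinite, \<open>triple_prod\<close> is nonzero; otherwise \<open>triple_sum\<close> and
  \<open>triple_prod\<close> are, up to nonzero factors, the denominator and the numerator of the
  duplication formula, which share no root.\<close>

lemma triple_no_common_zero:
  assumes 1: "f1 \<noteq> 0 \<or> g1 \<noteq> 0" and 2: "f2 \<noteq> 0 \<or> g2 \<noteq> (0::'k)"
    and z: "triple_den f1 g1 f2 g2 = 0" "triple_sum A B f1 g1 f2 g2 = 0" "triple_prod A B f1 g1 f2 g2 = 0"
  shows False
proof -
  have eq: "f1 * g2 = f2 * g1" using z(1) by (simp add: triple_den_def)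
  show False
  proof (cases "g1 = 0")
    case True
    then have "f1 \<noteq> 0" using 1 by simp
    then have "g2 = 0" using eq True by simp
    then show False using 2 z(3) True \<open>f1 \<noteq> 0\<close> by (simp add: triple_prod_def)
  next
    case False
    then have g2: "g2 \<noteq> 0" using eq 2 by auto
    define X where "X = f1 / g1"
    have f1: "f1 = X * g1" using False by (simp add: X_def)
    have f2: "f2 = X * g2" using eq False by (simp add: f1)
    have "triple_sum A B f1 g1 f2 g2 = (2 * 2) * (g1 ^ 2 * g2 ^ 2 * (X ^ 3 + A * X + B))"
      unfolding triple_sum_def f1 f2 by algebra
    then have "X ^ 3 + A * X + B = 0" using z(2) four_nz g2 False by simp
    moreover have "triple_prod A B f1 g1 f2 g2 = g1 ^ 2 * g2 ^ 2 * (X ^ 4 - 2 * A * X ^ 2 - 8 * B * X + A ^ 2)"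
      unfolding triple_prod_def f1 f2 by algebra
    then have "X ^ 4 - 2 * A * X ^ 2 - 8 * B * X + A ^ 2 = 0" using z(3) g2 False by simp
    ultimately show False using no_root_cubic_and_doubling by blast
  qed
qed

lemma padd_on_curve:
  assumes "on_curve A B P" "on_curve A B Q"
  shows "on_curve A B (padd A P Q)"
proof (cases P; cases Q)
  fix x1 y1 x2 y2 assume PQ: "P = Pt x1 y1" "Q = Pt x2 y2"
  have c1: "y1 ^ 2 = x1 ^ 3 + A * x1 + B" and c2: "y2 ^ 2 = x2 ^ 3 + A * x2 + B"
    using assms PQ by auto
  show ?thesis
  proof (cases "x1 = x2 \<and> y1 = - y2")
    case False
    define l where "l = (if x1 = x2 then (3 * x1 ^ 2 + A) / (2 * y1) else (y2 - y1) / (x2 - x1))"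
    define x3 where "x3 = l ^ 2 - x1 - x2"
    have sum: "padd A P Q = Pt x3 (l * (x1 - x3) - y1)"
      using False PQ by (simp add: Let_def l_def x3_def)
    have "(l * (x1 - x3) - y1) ^ 2 = x3 ^ 3 + A * x3 + B"
    proof (cases "x1 = x2")
      case True
      then have "y1 ^ 2 = y2 ^ 2" using c1 c2 by simp
      then have "y1 = y2" using False True by (auto simp: power2_eq_iff)
      then have "2 * y1 \<noteq> 0" using False True two_nz by (simp add: eq_neg_iff_add_eq_0 flip: mult_2)
      then have "l * (2 * y1) = 3 * x1 ^ 2 + A" using True by (simp add: l_def)
      then show ?thesis using c1 True unfolding x3_def by algebra
    next
      case False
      then have "l * (x2 - x1) = y2 - y1" "x2 - x1 \<noteq> 0" by (simp_all add: l_def)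
      moreover have "(x2 - x1) * ((l * (x1 - x3) - y1) ^ 2 - (x3 ^ 3 + A * x3 + B)) = 0"
        using c1 c2 calculation(1) unfolding x3_def by algebra
      ultimately show ?thesis by simp
    qed
    then show ?thesis using sum by simp
  qed (use PQ in simp)
qed (use assms in auto)

text \<open>The x-coordinates of \<open>P + Q\<close> and \<open>P - Q\<close> are the roots of a quadratic whose coefficients
  are bihomogeneous in the x-coordinates of \<open>P\<close> and \<open>Q\<close>.\<close>

lemma triple_x_rep:
  assumes P: "on_curve A B P" and Q: "on_curve A B Q"
  defines "S \<equiv> x_rep (padd A P Q)" and "D \<equiv> x_rep (padd A P (pneg Q))"
  defines "d \<equiv> triple_den (fst (x_rep P)) (snd (x_rep P)) (fst (x_rep Q)) (snd (x_rep Q))"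
    and "s \<equiv> triple_sum A B (fst (x_rep P)) (snd (x_rep P)) (fst (x_rep Q)) (snd (x_rep Q))"
    and "m \<equiv> triple_prod A B (fst (x_rep P)) (snd (x_rep P)) (fst (x_rep Q)) (snd (x_rep Q))"
  shows "snd S * snd D * s = (fst S * snd D + fst D * snd S) * d \<and>
    snd S * snd D * m = fst S * fst D * d \<and>
    (fst S * snd D + fst D * snd S) * m = fst S * fst D * s"
proof (cases P; cases Q)
  fix x1 y1 x2 y2 assume PQ: "P = Pt x1 y1" "Q = Pt x2 y2"
  have c1: "y1 ^ 2 = x1 ^ 3 + A * x1 + B" and c2: "y2 ^ 2 = x2 ^ 3 + A * x2 + B"
    using assms PQ by auto
  show ?thesis
  proof (cases "x1 = x2")
    case False
    define l where "l = (y2 - y1) / (x2 - x1)"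
    define k where "k = (- y2 - y1) / (x2 - x1)"
    have l: "l * (x2 - x1) = y2 - y1" and k: "k * (x2 - x1) = - y2 - y1"
      using False by (simp_all add: l_def k_def)
    have S: "S = (l ^ 2 - x1 - x2, 1)" and D: "D = (k ^ 2 - x1 - x2, 1)"
      using False PQ by (simp_all add: S_def D_def Let_def l_def k_def)
    have d: "d = (x2 - x1) ^ 2" unfolding d_def PQ triple_den_def by (simp add: power2_commute)
    have s: "(l ^ 2 - x1 - x2 + (k ^ 2 - x1 - x2)) * d = s"
      using l k c1 c2 unfolding d s_def PQ triple_sum_def by (simp, algebra)
    have m: "((l ^ 2 - x1 - x2) * (k ^ 2 - x1 - x2)) * d = m"
    proof -
      \<comment> \<open>Each of \<open>l ^ 2\<close> and \<open>k ^ 2\<close> needs a factor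
        \<open>d\<close> to become polynomial in the coordinates, so the identity is proved with one
        surplus factor \<open>d\<close>, cancelled afterwards.\<close>
      have "d * (((l ^ 2 - x1 - x2) * (k ^ 2 - x1 - x2)) * d - m) = 0"
      proof -
        have "d * l ^ 2 = (y2 - y1) ^ 2" "d * k ^ 2 = (y2 + y1) ^ 2"
          unfolding d using l k by algebra+
        then have "d * d * ((l ^ 2 - x1 - x2) * (k ^ 2 - x1 - x2)) =
            ((y2 - y1) ^ 2 - (x1 + x2) * d) * ((y2 + y1) ^ 2 - (x1 + x2) * d)"
          by algebra
        moreover have "((y2 - y1) ^ 2 - (x1 + x2) * d) * ((y2 + y1) ^ 2 - (x1 + x2) * d) = d * m"
          using c1 c2 unfolding d m_def PQ triple_prod_def by (simp, algebra)
        ultimately show ?thesis by algebra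
      qed
      moreover have "d \<noteq> 0" using False unfolding d by simp
      ultimately show ?thesis by simp
    qed
    show ?thesis unfolding S D s[symmetric] m[symmetric] by simp
  next
    case True
    have d: "d = 0" unfolding d_def PQ triple_den_def using True by simp
    have s: "s = 4 * y1 ^ 2" unfolding s_def PQ triple_sum_def unfolding True[symmetric] c1 by (simp, algebra)
    have m: "m = x1 ^ 4 - 2 * A * x1 ^ 2 - 8 * B * x1 + A ^ 2"
      unfolding m_def PQ triple_prod_def True[symmetric] by (simp, algebra)
    \<comment> \<open>With equal x-coordinates, one of P + Q and P - Q is infinite and the other is
      2P; at a 2-torsion point both are infinite.\<close>
    have "y1 ^ 2 = y2 ^ 2" using c1 c2 True by simp
    then have y: "y1 = y2 \<or> y1 = - y2" by (simp add: power2_eq_iff)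
    show ?thesis
    proof (cases "y1 = 0")
      case True
      then have "S = (1, 0)" "D = (1, 0)" using y \<open>x1 = x2\<close> by (auto simp: S_def D_def PQ)
      then show ?thesis using True d s m by simp
    next
      case False
      then have y2: "2 * y1 \<noteq> 0" using two_nz by simp
      then have neq: "y1 \<noteq> - y1" by (simp add: eq_neg_iff_add_eq_0 flip: mult_2)
      define l where "l = (3 * x1 ^ 2 + A) / (2 * y1)"
      have l: "l * (2 * y1) = 3 * x1 ^ 2 + A" using y2 by (simp add: l_def)
      have "(l ^ 2 - x1 - x1) * s = m" using l c1 unfolding s m by algebra
      moreover have "(S = (1, 0) \<and> D = (l ^ 2 - x1 - x1, 1)) \<or> (D = (1, 0) \<and> S = (l ^ 2 - x1 - x1, 1))"
        using y neq True by (auto simp: S_def D_def PQ Let_def l_def)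
      ultimately show ?thesis using d by auto
    qed
  qed
qed (simp_all add: S_def D_def d_def s_def m_def triple_den_def triple_sum_def triple_prod_def
      power2_eq_square)

text \<open>Rescaling the pairs of P and Q by \<open>a\<close> and \<open>b\<close> multiplies all
  three expressions by the same \<open>a ^ 2 * b ^ 2\<close>, so the projective identities pass from
  normalised to arbitrary coordinates. The pair \<open>(0, 0)\<close> satisfies \<open>has_x\<close>
  for every point and has to be excluded.\<close>

lemma triple_has_x:
  assumes P: "on_curve A B P" and Q: "on_curve A B Q"
    and x: "has_x P f1 g1" "has_x Q f2 g2" "has_x (padd A P Q) f3 g3" "has_x (padd A P (pneg Q)) f4 g4"
    and nz: "f1 \<noteq> 0 \<or> g1 \<noteq> 0" "f2 \<noteq> 0 \<or> g2 \<noteq> 0" "f3 \<noteq> 0 \<or> g3 \<noteq> 0" "f4 \<noteq> 0 \<or> g4 \<noteq> 0"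
  shows "g3 * g4 * triple_sum A B f1 g1 f2 g2 = (f3 * g4 + f4 * g3) * triple_den f1 g1 f2 g2"
    and "g3 * g4 * triple_prod A B f1 g1 f2 g2 = f3 * f4 * triple_den f1 g1 f2 g2"
    and "(f3 * g4 + f4 * g3) * triple_prod A B f1 g1 f2 g2 = f3 * f4 * triple_sum A B f1 g1 f2 g2"
proof -
  obtain a b c d where s: "f1 = a * fst (x_rep P)" "g1 = a * snd (x_rep P)"
    "f2 = b * fst (x_rep Q)" "g2 = b * snd (x_rep Q)"
    "f3 = c * fst (x_rep (padd A P Q))" "g3 = c * snd (x_rep (padd A P Q))"
    "f4 = d * fst (x_rep (padd A P (pneg Q)))" "g4 = d * snd (x_rep (padd A P (pneg Q)))"
    using has_x_scale[OF x(1) nz(1)] has_x_scale[OF x(2) nz(2)] has_x_scale[OF x(3) nz(3)]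
      has_x_scale[OF x(4) nz(4)] by metis
  have den: "triple_den f1 g1 f2 g2 =
      a ^ 2 * b ^ 2 * triple_den (fst (x_rep P)) (snd (x_rep P)) (fst (x_rep Q)) (snd (x_rep Q))"
    unfolding triple_den_def s by algebra
  have sum: "triple_sum A B f1 g1 f2 g2 =
      a ^ 2 * b ^ 2 * triple_sum A B (fst (x_rep P)) (snd (x_rep P)) (fst (x_rep Q)) (snd (x_rep Q))"
    unfolding triple_sum_def s by algebra
  have prod: "triple_prod A B f1 g1 f2 g2 =
      a ^ 2 * b ^ 2 * triple_prod A B (fst (x_rep P)) (snd (x_rep P)) (fst (x_rep Q)) (snd (x_rep Q))"
    unfolding triple_prod_def s by algebra
  note t = triple_x_rep[OF P Q]
  show "g3 * g4 * triple_sum A B f1 g1 f2 g2 = (f3 * g4 + f4 * g3) * triple_den f1 g1 f2 g2"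
    unfolding den sum s(5-8) using t by algebra
  show "g3 * g4 * triple_prod A B f1 g1 f2 g2 = f3 * f4 * triple_den f1 g1 f2 g2"
    unfolding den prod s(5-8) using t by algebra
  show "(f3 * g4 + f4 * g3) * triple_prod A B f1 g1 f2 g2 = f3 * f4 * triple_sum A B f1 g1 f2 g2"
    unfolding sum prod s(5-8) using t by algebra
qed

end

section \<open>The x-coordinate map of an endomorphism\<close>

lemma coprime_quotient_exists:
  fixes a c :: "'a::field poly"
  assumes "c \<noteq> 0"
  shows "\<exists>d f g. a = d * f \<and> c = d * g \<and> (\<forall>x. poly f x \<noteq> 0 \<or> poly g x \<noteq> 0)"
  using assms
proof (induction "degree c" arbitrary: a c rule: less_induct)
  case less
  show ?case
  proof (cases "\<exists>x. poly a x = 0 \<and> poly c x = 0")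
    case False
    then show ?thesis by (intro exI[of _ 1] exI[of _ a] exI[of _ c]) auto
  next
    case True
    then obtain x a' c' where ac: "a = [:- x, 1:] * a'" "c = [:- x, 1:] * c'"
      unfolding poly_eq_0_iff_dvd by (auto simp only: dvd_def)
    then have "c' \<noteq> 0" using less.prems by auto
    then have "degree c' < degree c" unfolding ac by (subst degree_mult_eq) auto
    then obtain d f g where "a' = d * f" "c' = d * g" "\<forall>x. poly f x \<noteq> 0 \<or> poly g x \<noteq> 0"
      using less.hyps[OF _ \<open>c' \<noteq> 0\<close>, of a'] by blast
    then show ?thesis using ac by (intro exI[of _ "[:- x, 1:] * d"] exI[of _ f] exI[of _ g]) (simp only: mult.assoc, simp)
  qed
qed

lemma has_x_unique: "has_x P a b \<Longrightarrow> has_x P a' b' \<Longrightarrow> a * b' = b * a'"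
  by (cases P) auto

section \<open>Identities that hold at all but finitely many points\<close>

context elliptic
begin

lemma ex_on_curve: "\<exists>y. on_curve A B (Pt x y)"
  using nth_root_exists[of 2 "x ^ 3 + A * x + B"] by auto

text \<open>Exceptional points are collected by their x-coordinates, which makes the notion stable
  under P -> -P. Every x-coordinate has a point above it and the field is infinite, so generic
  equality of polynomials is equality.\<close>

definition generic :: "('k \<Rightarrow> 'k \<Rightarrow> bool) \<Rightarrow> bool" where
  "generic R \<longleftrightarrow> (\<exists>X. finite X \<and> (\<forall>x y. x \<notin> X \<longrightarrow> on_curve A B (Pt x y) \<longrightarrow> R x y))"

lemma genericI: "finite X \<Longrightarrow> (\<And>x y. x \<notin> X \<Longrightarrow> on_curve A B (Pt x y) \<Longrightarrow> R x y) \<Longrightarrow> generic R"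
  unfolding generic_def by blast

lemma generic_True: "(\<And>x y. on_curve A B (Pt x y) \<Longrightarrow> R x y) \<Longrightarrow> generic R"
  by (rule genericI[of "{}"]) auto

lemma generic_conj: "generic R \<Longrightarrow> generic S \<Longrightarrow> generic (\<lambda>x y. R x y \<and> S x y)"
proof -
  assume "generic R" "generic S"
  then obtain X Y where "finite X" "finite Y"
    "\<And>x y. x \<notin> X \<Longrightarrow> on_curve A B (Pt x y) \<Longrightarrow> R x y"
    "\<And>x y. x \<notin> Y \<Longrightarrow> on_curve A B (Pt x y) \<Longrightarrow> S x y"
    unfolding generic_def by blast
  then show ?thesis by (intro genericI[of "X \<union> Y"]) auto
qed

lemma generic_mono:
  assumes "generic R" "\<And>x y. on_curve A B (Pt x y) \<Longrightarrow> R x y \<Longrightarrow> S x y"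
  shows "generic S"
  using assms unfolding generic_def by metis

lemma generic_neg: "generic R \<Longrightarrow> generic (\<lambda>x y. R x (- y))"
proof -
  assume "generic R"
  then obtain X where "finite X" "\<And>x y. x \<notin> X \<Longrightarrow> on_curve A B (Pt x y) \<Longrightarrow> R x y"
    unfolding generic_def by blast
  then show ?thesis by (intro genericI[of X]) auto
qed

lemma generic_poly_nz: "f \<noteq> 0 \<Longrightarrow> generic (\<lambda>x y. poly f x \<noteq> 0)"
  by (rule genericI[of "{x. poly f x = 0}"]) (auto simp: poly_roots_finite)

lemma generic_y_nz: "generic (\<lambda>x y. y \<noteq> 0)"
proof (rule generic_mono[OF generic_poly_nz])
  show "[:B, A, 0, 1:] \<noteq> 0" by simp
  fix x y assume "on_curve A B (Pt x y)" "poly [:B, A, 0, 1:] x \<noteq> 0"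
  then show "y \<noteq> 0" by (auto simp: algebra_simps power3_eq_cube)
qed

lemma generic_ex:
  assumes "generic R"
  shows "\<exists>x y. on_curve A B (Pt x y) \<and> R x y"
proof -
  obtain X where X: "finite X" "\<And>x y. x \<notin> X \<Longrightarrow> on_curve A B (Pt x y) \<Longrightarrow> R x y"
    using assms unfolding generic_def by blast
  then obtain x where "x \<notin> X" using alg_closed_infinite ex_new_if_finite by blast
  then show ?thesis using X ex_on_curve by blast
qed

lemma generic_poly_eq:
  assumes "generic (\<lambda>x y. poly f x = poly g x)"
  shows "f = g"
proof -
  obtain X where X: "finite X" "\<And>x y. x \<notin> X \<Longrightarrow> on_curve A B (Pt x y) \<Longrightarrow> poly f x = poly g x"
    using assms unfolding generic_def by blast
  then have "- X \<subseteq> {x. poly f x = poly g x}" using ex_on_curve by blast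
  moreover have "infinite (- X)" using X(1) alg_closed_infinite by (simp add: Compl_eq_Diff_UNIV)
  ultimately show ?thesis using poly_eqI_infinite finite_subset by blast
qed

lemma generic_finite_exceptions:
  assumes "finite {(x, y). on_curve A B (Pt x y) \<and> \<not> R x y}"
  shows "generic R"
  by (rule genericI[of "fst ` {(x, y). on_curve A B (Pt x y) \<and> \<not> R x y}"]) (use assms in force)+

text \<open>The pair is the map x(P) -> x(\<open>\<phi>\<close> P) in lowest terms: over an
  algebraically closed field, having no common root is coprimality. Hence the pair is unique up to a
  constant.\<close>

definition rep :: "('k point \<Rightarrow> 'k point) \<Rightarrow> 'k poly \<Rightarrow> 'k poly \<Rightarrow> bool" where
  "rep \<phi> f g \<longleftrightarrow> (\<forall>x. poly f x \<noteq> 0 \<or> poly g x \<noteq> 0) \<and>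
     generic (\<lambda>x y. has_x (\<phi> (Pt x y)) (poly f x) (poly g x))"

lemma rep_nz: "rep \<phi> f g \<Longrightarrow> poly f x \<noteq> 0 \<or> poly g x \<noteq> 0"
  by (simp add: rep_def)

lemma rep_generic: "rep \<phi> f g \<Longrightarrow> generic (\<lambda>x y. has_x (\<phi> (Pt x y)) (poly f x) (poly g x))"
  by (simp add: rep_def)

lemma rep_cong:
  assumes "rep \<phi> f g" "\<And>x y. on_curve A B (Pt x y) \<Longrightarrow> \<psi> (Pt x y) = \<phi> (Pt x y) \<or> \<psi> (Pt x y) = pneg (\<phi> (Pt x y))"
  shows "rep \<psi> f g"
  unfolding rep_def
proof (intro conjI allI)
  show "generic (\<lambda>x y. has_x (\<psi> (Pt x y)) (poly f x) (poly g x))"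
    by (rule generic_mono[OF rep_generic[OF assms(1)]]) (metis assms(2) has_x_pneg)
qed (use rep_nz[OF assms(1)] in blast)

lemma rep_unique:
  assumes "rep \<phi> f g" "rep \<phi> f' g'"
  shows "\<exists>c. c \<noteq> 0 \<and> f = smult c f' \<and> g = smult c g'"
proof -
  have "f * g' = g * f'"
  proof (rule generic_poly_eq, rule generic_mono[OF generic_conj[OF assms[THEN rep_generic]]])
    fix x y
    assume "has_x (\<phi> (Pt x y)) (poly f x) (poly g x) \<and> has_x (\<phi> (Pt x y)) (poly f' x) (poly g' x)"
    then show "poly (f * g') x = poly (g * f') x" using has_x_unique by auto
  qed
  then show ?thesis
    using proportional_primitive_triples[of f g 0 f' g' 0] rep_nz[OF assms(1)] rep_nz[OF assms(2)] by auto
qed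

text \<open>Pointwise proportionality at generic points gives proportionality of polynomial triples.
  Both triples are without common roots, so the factor is a constant, and degrees may be compared
  exactly.\<close>

lemma rep_triple:
  assumes r: "rep \<phi>1 f1 g1" "rep \<phi>2 f2 g2" "rep \<phi>3 f3 g3" "rep \<phi>4 f4 g4"
    and on: "\<And>x y. on_curve A B (Pt x y) \<Longrightarrow> on_curve A B (\<phi>1 (Pt x y))"
      "\<And>x y. on_curve A B (Pt x y) \<Longrightarrow> on_curve A B (\<phi>2 (Pt x y))"
    and sum: "\<And>x y. on_curve A B (Pt x y) \<Longrightarrow> \<phi>3 (Pt x y) = padd A (\<phi>1 (Pt x y)) (\<phi>2 (Pt x y))"
    and diff: "\<And>x y. on_curve A B (Pt x y) \<Longrightarrow> \<phi>4 (Pt x y) = padd A (\<phi>1 (Pt x y)) (pneg (\<phi>2 (Pt x y)))"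
  shows "\<exists>c. c \<noteq> 0 \<and> g3 * g4 = smult c (triple_den f1 g1 f2 g2) \<and>
    f3 * g4 + f4 * g3 = smult c (triple_sum [:A:] [:B:] f1 g1 f2 g2) \<and>
    f3 * f4 = smult c (triple_prod [:A:] [:B:] f1 g1 f2 g2)"
proof -
  have pd: "poly (triple_den f1 g1 f2 g2) x = triple_den (poly f1 x) (poly g1 x) (poly f2 x) (poly g2 x)"
    and ps: "poly (triple_sum [:A:] [:B:] f1 g1 f2 g2) x = triple_sum A B (poly f1 x) (poly g1 x) (poly f2 x) (poly g2 x)"
    and pp: "poly (triple_prod [:A:] [:B:] f1 g1 f2 g2) x = triple_prod A B (poly f1 x) (poly g1 x) (poly f2 x) (poly g2 x)" for x
    by (simp_all add: triple_den_def triple_sum_def triple_prod_def algebra_simps)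
  have gen: "generic (\<lambda>x y. (has_x (\<phi>1 (Pt x y)) (poly f1 x) (poly g1 x) \<and> has_x (\<phi>2 (Pt x y)) (poly f2 x) (poly g2 x))
     \<and> (has_x (\<phi>3 (Pt x y)) (poly f3 x) (poly g3 x) \<and> has_x (\<phi>4 (Pt x y)) (poly f4 x) (poly g4 x)))"
    by (intro generic_conj r[THEN rep_generic])
  note t = triple_has_x[OF on _ _ _ _ rep_nz[OF r(1)] rep_nz[OF r(2)] rep_nz[OF r(3)] rep_nz[OF r(4)]]
  have e: "generic (\<lambda>x y. poly (g3 * g4 * triple_sum [:A:] [:B:] f1 g1 f2 g2) x
         = poly ((f3 * g4 + f4 * g3) * triple_den f1 g1 f2 g2) x \<and>
      poly (g3 * g4 * triple_prod [:A:] [:B:] f1 g1 f2 g2) x = poly (f3 * f4 * triple_den f1 g1 f2 g2) x \<and>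
      poly ((f3 * g4 + f4 * g3) * triple_prod [:A:] [:B:] f1 g1 f2 g2) x =
         poly (f3 * f4 * triple_sum [:A:] [:B:] f1 g1 f2 g2) x)"
    unfolding poly_mult poly_add pd ps pp
    by (rule generic_mono[OF gen], intro conjI t; (simp only: sum diff)?; blast?)
  have "g3 * g4 * triple_sum [:A:] [:B:] f1 g1 f2 g2 = (f3 * g4 + f4 * g3) * triple_den f1 g1 f2 g2"
    "g3 * g4 * triple_prod [:A:] [:B:] f1 g1 f2 g2 = f3 * f4 * triple_den f1 g1 f2 g2"
    "(f3 * g4 + f4 * g3) * triple_prod [:A:] [:B:] f1 g1 f2 g2 = f3 * f4 * triple_sum [:A:] [:B:] f1 g1 f2 g2"
    by (rule generic_poly_eq, rule generic_mono[OF e], blast)+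
  then show ?thesis
  proof (intro proportional_primitive_triples)
    fix x
    \<comment> \<open>Up to sign these are the coefficients of a product of two nonzero linear
      forms, so they cannot all vanish.\<close>
    show "poly (g3 * g4) x \<noteq> 0 \<or> poly (f3 * g4 + f4 * g3) x \<noteq> 0 \<or> poly (f3 * f4) x \<noteq> 0"
      using rep_nz[OF r(3), of x] rep_nz[OF r(4), of x] by auto
    show "poly (triple_den f1 g1 f2 g2) x \<noteq> 0 \<or> poly (triple_sum [:A:] [:B:] f1 g1 f2 g2) x \<noteq> 0 \<or>
       poly (triple_prod [:A:] [:B:] f1 g1 f2 g2) x \<noteq> 0"
      unfolding pd ps pp using triple_no_common_zero[OF rep_nz[OF r(1)] rep_nz[OF r(2)]] by blast
  qed auto
qed

text \<open>Homogenised composition keeps the pair without common roots. Nonconstancy of the inner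
  map ensures that only finitely many x are sent to infinity or into the exceptional set of the
  outer map.\<close>

lemma rep_comp:
  assumes r: "rep \<theta> F G" and s: "rep \<phi> f g"
    and on: "\<And>x y. on_curve A B (Pt x y) \<Longrightarrow> on_curve A B (\<phi> (Pt x y))"
    and n: "degree F \<le> n" "degree G \<le> n" "coeff F n \<noteq> 0 \<or> coeff G n \<noteq> 0"
    and nonconst: "degree f > 0 \<or> degree g > 0"
  shows "rep (\<lambda>P. \<theta> (\<phi> P)) (hcomp n F f g) (hcomp n G f g)"
  unfolding rep_def poly_hcomp
proof (intro conjI allI)
  show "heval n F (poly f x) (poly g x) \<noteq> 0 \<or> heval n G (poly f x) (poly g x) \<noteq> 0" for x
    by (rule heval_no_common_zero[OF rep_nz[OF r] n rep_nz[OF s]])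
  obtain X where X: "finite X"
    "\<And>x y. x \<notin> X \<Longrightarrow> on_curve A B (Pt x y) \<Longrightarrow> has_x (\<theta> (Pt x y)) (poly F x) (poly G x)"
    using rep_generic[OF r] unfolding generic_def by blast
  have "g \<noteq> 0"
  proof
    assume "g = 0"
    then have "\<And>x. poly f x \<noteq> 0" using rep_nz[OF s] by auto
    then have "degree f = 0" using alg_closed_imp_poly_has_root by blast
    then show False using nonconst \<open>g = 0\<close> by simp
  qed
  \<comment> \<open>The roots of this polynomial are the x mapped to the exceptional value
    \<open>e\<close>.\<close>
  moreover have "f - smult e g \<noteq> 0" for e
  proof
    assume "f - smult e g = 0"
    then have f: "f = smult e g" by simp
    then have "\<And>x. poly g x \<noteq> 0" using rep_nz[OF s] by auto
    then have "degree g = 0" using alg_closed_imp_poly_has_root by blast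
    then show False using nonconst f by (simp split: if_splits)
  qed
  ultimately have "g * (\<Prod>e\<in>X. f - smult e g) \<noteq> 0" using X(1) by simp
  note gen = generic_conj[OF generic_poly_nz[OF this] rep_generic[OF s]]
  show "generic (\<lambda>x y. has_x (\<theta> (\<phi> (Pt x y))) (heval n F (poly f x) (poly g x)) (heval n G (poly f x) (poly g x)))"
  proof (rule generic_mono[OF gen])
    fix x y
    assume c: "on_curve A B (Pt x y)"
      and a: "poly (g * (\<Prod>e\<in>X. f - smult e g)) x \<noteq> 0 \<and> has_x (\<phi> (Pt x y)) (poly f x) (poly g x)"
    have g: "poly g x \<noteq> 0" and e: "\<And>e. e \<in> X \<Longrightarrow> poly f x \<noteq> e * poly g x"
      using a X(1) by (auto simp: poly_prod)
    obtain x' y' where P: "\<phi> (Pt x y) = Pt x' y'" using a g by (cases "\<phi> (Pt x y)") auto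
    then have f: "poly f x = x' * poly g x" using a by simp
    then have "x' \<notin> X" using e by blast
    then have "has_x (\<theta> (Pt x' y')) (poly F x') (poly G x')" using X(2) on[OF c] P by simp
    then show "has_x (\<theta> (\<phi> (Pt x y))) (heval n F (poly f x) (poly g x)) (heval n G (poly f x) (poly g x))"
      unfolding f heval_mult[OF n(1)] heval_mult[OF n(2)] P
      by (cases "\<theta> (Pt x' y')") auto
  qed
qed

lemma endo_on: "is_endo A B \<phi> \<Longrightarrow> on_curve A B P \<Longrightarrow> on_curve A B (\<phi> P)"
  unfolding is_endo_def by blast

lemma endo_hom: "is_endo A B \<phi> \<Longrightarrow> on_curve A B P \<Longrightarrow> on_curve A B Q \<Longrightarrow> \<phi> (padd A P Q) = padd A (\<phi> P) (\<phi> Q)"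
  unfolding is_endo_def by blast

lemma padd_self_eq: "padd A R R = R \<Longrightarrow> R = Inf"
  using two_nz by (cases R) (auto simp: Let_def eq_neg_iff_add_eq_0 split: if_splits simp flip: mult_2)

lemma endo_Inf: "is_endo A B \<phi> \<Longrightarrow> \<phi> Inf = Inf"
  using endo_hom[of \<phi> Inf Inf] padd_self_eq by simp

lemma endo_pneg:
  assumes "is_endo A B \<phi>" "on_curve A B P"
  shows "\<phi> (pneg P) = pneg (\<phi> P)"
  using endo_hom[OF assms, of "pneg P"] assms(2) endo_Inf[OF assms(1)]
    padd_eq_Inf_iff[of A "\<phi> P" "\<phi> (pneg P)"] by simp

lemma endo_rep:
  assumes e: "is_endo A B \<phi>"
  shows "\<exists>f g. rep \<phi> f g"
proof (cases "\<forall>P. \<phi> P = Inf")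
  case True
  then have "rep \<phi> 1 0" unfolding rep_def by (auto intro: generic_True)
  then show ?thesis by blast
next
  case False
  then obtain a1 b1 c1 a2 b2 c2 where nz: "c1 \<noteq> 0" and fin: "finite {(x, y). on_curve A B (Pt x y) \<and>
              \<not> (poly c1 x \<noteq> 0 \<and> poly c2 x \<noteq> 0 \<and>
                 \<phi> (Pt x y) = Pt ((poly a1 x + poly b1 x * y) / poly c1 x)
                                  ((poly a2 x + poly b2 x * y) / poly c2 x))}"
    using e unfolding is_endo_def by (elim conjE disjE) auto
  note gen = generic_finite_exceptions[OF fin]
  \<comment> \<open>Since \<open>\<phi>\<close> commutes with negation, its x-coordinate is the same
    at \<open>(x, y)\<close> and \<open>(x, - y)\<close>; comparing the two formulas gives
    \<open>2 * b1 * y = 0\<close>.\<close>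
  have b1: "b1 = 0"
  proof (rule generic_poly_eq, rule generic_mono[OF generic_conj[OF gen generic_conj[OF generic_neg[OF gen] generic_y_nz]]])
    fix x y
    assume c: "on_curve A B (Pt x y)" and h: "(poly c1 x \<noteq> 0 \<and> poly c2 x \<noteq> 0 \<and>
         \<phi> (Pt x y) = Pt ((poly a1 x + poly b1 x * y) / poly c1 x) ((poly a2 x + poly b2 x * y) / poly c2 x)) \<and>
         (poly c1 x \<noteq> 0 \<and> poly c2 x \<noteq> 0 \<and>
         \<phi> (Pt x (- y)) = Pt ((poly a1 x + poly b1 x * - y) / poly c1 x) ((poly a2 x + poly b2 x * - y) / poly c2 x)) \<and>
         y \<noteq> 0"
    then have "poly b1 x * y = - (poly b1 x * y)" using endo_pneg[OF e c] by simp
    then have "2 * (poly b1 x * y) = 0" by (simp add: eq_neg_iff_add_eq_0 flip: mult_2)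
    then show "poly b1 x = poly 0 x" using h two_nz by simp
  qed
  obtain d f g where d: "a1 = d * f" "c1 = d * g" and co: "\<forall>x. poly f x \<noteq> 0 \<or> poly g x \<noteq> 0"
    using coprime_quotient_exists[OF nz] by blast
  have "rep \<phi> f g"
    unfolding rep_def
    by (intro conjI co, rule generic_mono[OF gen]) (simp add: b1 d field_simps)
  then show ?thesis by blast
qed

text \<open>A zero denominator sends generic points to infinity, whereas a nonzero endomorphism has
  finite values at generic points by its rational formulas.\<close>

lemma endo_zero:
  assumes "is_endo A B \<phi>" "rep \<phi> f 0"
  shows "\<phi> P = Inf"
proof (rule ccontr)
  assume "\<phi> P \<noteq> Inf"
  then obtain a1 b1 c1 a2 b2 c2 where fin: "finite {(x, y). on_curve A B (Pt x y) \<and>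
              \<not> (poly c1 x \<noteq> 0 \<and> poly c2 x \<noteq> 0 \<and>
                 \<phi> (Pt x y) = Pt ((poly a1 x + poly b1 x * y) / poly c1 x)
                                  ((poly a2 x + poly b2 x * y) / poly c2 x))}"
    using assms(1) unfolding is_endo_def by (elim conjE disjE) auto
  have nz: "\<And>x. poly f x \<noteq> 0" using rep_nz[OF assms(2)] by simp
  have "generic (\<lambda>x y. False)"
    by (rule generic_mono[OF generic_conj[OF generic_finite_exceptions[OF fin] rep_generic[OF assms(2)]]])
      (auto simp: nz)
  then show False using generic_ex by blast
qed

lemma rep_id: "rep (\<lambda>P. P) [:0, 1:] 1"
  unfolding rep_def by (auto intro: generic_True)

text \<open>Numerator and denominator of the duplication formula for x(2P).\<close>

definition dbl_num :: "'k poly" where "dbl_num = [:A ^ 2, - 8 * B, - 2 * A, 0, 1:]"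
definition dbl_den :: "'k poly" where "dbl_den = [:4 * B, 4 * A, 0, 4:]"

lemma poly_dbl:
  "poly dbl_num x = x ^ 4 - 2 * A * x ^ 2 - 8 * B * x + A ^ 2"
  "poly dbl_den x = 4 * (x ^ 3 + A * x + B)"
  unfolding dbl_num_def dbl_den_def by (simp_all add: algebra_simps power2_eq_square power3_eq_cube power4_eq_xxxx)

lemma has_x_dbl:
  assumes "on_curve A B P" "has_x P x 1"
  shows "has_x (padd A P P) (poly dbl_num x) (poly dbl_den x)"
proof -
  obtain y where P: "P = Pt x y" using assms by (cases P) auto
  then have c: "y ^ 2 = x ^ 3 + A * x + B" using assms by simp
  show ?thesis
  proof (cases "y = 0")
    case True
    then show ?thesis using P c by (simp add: poly_dbl)
  next
    case False
    then have y2: "2 * y \<noteq> 0" using two_nz by simp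
    then have neq: "y \<noteq> - y" by (simp add: eq_neg_iff_add_eq_0 flip: mult_2)
    define l where "l = (3 * x ^ 2 + A) / (2 * y)"
    have l: "l * (2 * y) = 3 * x ^ 2 + A" using y2 by (simp add: l_def)
    have "poly dbl_num x = (l ^ 2 - x - x) * poly dbl_den x"
      unfolding poly_dbl using l c by algebra
    then show ?thesis using neq by (simp add: P Let_def l_def)
  qed
qed

lemma dbl_no_common_root: "poly dbl_num x \<noteq> 0 \<or> poly dbl_den x \<noteq> 0"
  unfolding poly_dbl mult_eq_0_iff using no_root_cubic_and_doubling[of x] four_nz by blast

lemma rep_dbl: "rep (\<lambda>P. padd A P P) dbl_num dbl_den"
  unfolding rep_def by (intro conjI allI dbl_no_common_root generic_True has_x_dbl) auto

lemma degree_dbl: "degree dbl_num = 4" "degree dbl_den = 3"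
  using four_nz by (simp_all add: dbl_num_def dbl_den_def)

end

section \<open>The degree\<close>

text \<open>A degree bound together with the coefficient at the bound, which may be zero. For a pair
  bounded by \<open>m\<close>, the two coefficients at \<open>m\<close> are the image of
  infinity.\<close>

definition has_top :: "'a::comm_ring_1 poly \<Rightarrow> nat \<Rightarrow> 'a \<Rightarrow> bool" where
  "has_top p m c \<longleftrightarrow> degree p \<le> m \<and> coeff p m = c"

lemma has_top_mult: "has_top p m c \<Longrightarrow> has_top q n d \<Longrightarrow> has_top (p * q) (m + n) (c * d)"
  unfolding has_top_def using coeff_mult_le_degrees degree_mult_le_bounds by blast

lemma has_top_add: "has_top p m c \<Longrightarrow> has_top q m d \<Longrightarrow> has_top (p + q) m (c + d)"
  unfolding has_top_def by (simp add: degree_add_le)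

lemma has_top_diff: "has_top p m c \<Longrightarrow> has_top q m d \<Longrightarrow> has_top (p - q) m (c - d)"
  unfolding has_top_def by (simp add: degree_diff_le)

lemma has_top_power: "has_top p m c \<Longrightarrow> has_top (p ^ n) (n * m) (c ^ n)"
  unfolding has_top_def using coeff_power_le_degree by blast

lemma has_top_smult: "has_top p m c \<Longrightarrow> has_top (smult a p) m (a * c)"
  unfolding has_top_def using degree_smult_le[of a p] by auto

lemma has_top_degree: "has_top p m c \<Longrightarrow> c \<noteq> 0 \<Longrightarrow> degree p = m"
  unfolding has_top_def using le_degree by fastforce

lemma has_top_cong: "has_top p m c \<Longrightarrow> m = n \<Longrightarrow> c = d \<Longrightarrow> has_top p n d"
  by simp

lemma has_top_hcomp: "has_top u m a \<Longrightarrow> has_top v m b \<Longrightarrow> has_top (hcomp n f u v) (n * m) (heval n f a b)"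
  unfolding has_top_def using hcomp_degree_coeff by blast

lemma triple_den_top:
  assumes "has_top f1 m a1" "has_top g1 m b1" "has_top f2 n a2" "has_top g2 n b2"
  shows "has_top (triple_den f1 g1 f2 g2) (2 * (m + n)) ((a1 * b2 - a2 * b1) ^ 2)"
  unfolding triple_den_def
  by (intro has_top_power has_top_diff has_top_mult assms has_top_cong[OF has_top_mult[OF assms(3,2)]]) auto

lemma triple_prod_top:
  assumes "has_top f1 m a1" "has_top g1 m b1" "has_top f2 n a2" "has_top g2 n b2"
  shows "has_top (triple_prod [:A:] [:B:] f1 g1 f2 g2) (2 * (m + n)) (triple_prod A B a1 b1 a2 b2)"
proof -
  have c: "has_top [:a:] 0 a" for a :: 'a by (simp add: has_top_def)
  have 4: "(4 :: 'a poly) = [:4:]" by (simp add: numeral_poly)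
  have "has_top ((f1 * f2 - [:A:] * g1 * g2) ^ 2) (2 * (m + n)) ((a1 * a2 - A * b1 * b2) ^ 2)"
    by (intro has_top_power has_top_diff has_top_mult assms has_top_cong[OF has_top_mult[OF has_top_mult[OF c[of A] assms(2)] assms(4)]]) auto
  moreover have "has_top ([:4:] * [:B:] * (f1 * g2 + f2 * g1) * g1 * g2) (2 * (m + n)) (4 * B * (a1 * b2 + a2 * b1) * b1 * b2)"
  proof -
    have "has_top (f1 * g2 + f2 * g1) (m + n) (a1 * b2 + a2 * b1)"
      by (intro has_top_add has_top_mult assms has_top_cong[OF has_top_mult[OF assms(3,2)]]) auto
    from has_top_mult[OF has_top_mult[OF has_top_mult[OF has_top_mult[OF c[of 4] c[of B]] this] assms(2)] assms(4)]
    show ?thesis by (rule has_top_cong) auto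
  qed
  ultimately show ?thesis unfolding triple_prod_def 4 by (rule has_top_diff)
qed

lemma q_add_plus: "q_add q r = q + r"
  by (cases q; cases r) auto

text \<open>The difference \<open>E\<close> of \<open>D\<close> and the claimed form obeys the same
  law and vanishes at four points. Along a line the law is a second-order recursion, so the zeros
  spread over both axes of the lattice in either direction.\<close>

lemma parallelogram_imp_quadratic:
  fixes D :: "int \<Rightarrow> int \<Rightarrow> int"
  assumes par: "\<And>m l m' l'. D (m + m') (l + l') + D (m - m') (l - l') = 2 * D m l + 2 * D m' l'"
  shows "D m l = m ^ 2 * D 1 0 + m * l * (D 1 1 - D 1 0 - D 0 1) + l ^ 2 * D 0 1"
proof -
  define E where "E m l = D m l - (m ^ 2 * D 1 0 + m * l * (D 1 1 - D 1 0 - D 0 1) + l ^ 2 * D 0 1)" for m l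
  have E: "E (m + m') (l + l') + E (m - m') (l - l') = 2 * E m l + 2 * E m' l'" for m l m' l'
    using par[of m m' l l'] unfolding E_def by (simp add: algebra_simps power2_eq_square)
  have E0: "E 0 0 = 0" "E 1 0 = 0" "E 0 1 = 0" "E 1 1 = 0"
    using par[of 0 0 0 0] by (simp_all add: E_def)
  have bi: "P k" if "P 0" "P 1" "\<And>k. P k \<Longrightarrow> P (k + 1) \<Longrightarrow> P (k + 2)"
    "\<And>k. P (k + 1) \<Longrightarrow> P (k + 2) \<Longrightarrow> P k" for P :: "int \<Rightarrow> bool" and k
  proof -
    have "P (int n) \<and> P (int n + 1)" for n
      by (induction n) (use that in \<open>auto simp: add_ac\<close>)
    moreover have "P (- int n) \<and> P (- int n + 1)" for n
    proof (induction n)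
      case (Suc n)
      have "- int (Suc n) = - int n - 1" "- int n - 1 + 1 = - int n" "- int n - 1 + 2 = - int n + 1" by auto
      then show ?case using that(4)[of "- int n - 1"] Suc by metis
    qed (use that in auto)
    ultimately show ?thesis by (cases k rule: int_cases2) blast+
  qed
  have c0: "E 0 l = 0" for l
  proof (rule bi[of "\<lambda>l. E 0 l = 0"])
    show "E 0 (k + 2) = 0" if "E 0 k = 0" "E 0 (k + 1) = 0" for k
      using that E[of 0 0 "k + 1" 1] E0 by (simp add: algebra_simps)
    show "E 0 k = 0" if "E 0 (k + 1) = 0" "E 0 (k + 2) = 0" for k
      using that E[of 0 0 "k + 1" 1] E0 by (simp add: algebra_simps)
  qed (use E0 in auto)
  have c1: "E 1 l = 0" for l
  proof (rule bi[of "\<lambda>l. E 1 l = 0"])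
    show "E 1 (k + 2) = 0" if "E 1 k = 0" "E 1 (k + 1) = 0" for k
      using that E[of 1 0 "k + 1" 1] c0[of 1] by (simp add: algebra_simps)
    show "E 1 k = 0" if "E 1 (k + 1) = 0" "E 1 (k + 2) = 0" for k
      using that E[of 1 0 "k + 1" 1] c0[of 1] by (simp add: algebra_simps)
  qed (use E0 in auto)
  have "E m l = 0"
  proof (rule bi[of "\<lambda>m. E m l = 0"])
    show "E (k + 2) l = 0" if "E k l = 0" "E (k + 1) l = 0" for k
      using that E[of "k + 1" 1 l 0] c1[of 0] by (simp add: algebra_simps)
    show "E k l = 0" if "E (k + 1) l = 0" "E (k + 2) l = 0" for k
      using that E[of "k + 1" 1 l 0] c1[of 0] by (simp add: algebra_simps)
  qed (use c0 c1 in auto)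
  then show ?thesis by (simp add: E_def)
qed

section \<open>Arithmetic of endomorphisms through the Clifford order\<close>

abbreviation scal :: "int \<Rightarrow> q4" where "scal n \<equiv> (n, 0, 0, 0)"

locale endo_clf = elliptic A B for A B :: "'k::alg_closed_field" +
  fixes F :: tform and h :: "q4 \<Rightarrow> 'k point \<Rightarrow> 'k point"
  assumes iso: "clf_end_iso F A B h"
begin

lemma h_endo: "is_endo A B (h q)"
  using iso unfolding clf_end_iso_def bij_betw_def End_set_def by blast

lemma h_surj: "is_endo A B \<phi> \<Longrightarrow> \<exists>q. \<phi> = h q"
  using iso unfolding clf_end_iso_def bij_betw_def End_set_def by blast

lemma h_inj: "h q = h r \<Longrightarrow> q = r"
  using iso unfolding clf_end_iso_def bij_betw_def by (blast dest: injD)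

lemma h_on: "on_curve A B P \<Longrightarrow> on_curve A B (h q P)"
  using endo_on[OF h_endo] .

lemma h_off: "\<not> on_curve A B P \<Longrightarrow> h q P = Inf"
  using h_endo unfolding is_endo_def by blast

lemma h_hom: "on_curve A B P \<Longrightarrow> on_curve A B Q \<Longrightarrow> h q (padd A P Q) = padd A (h q P) (h q Q)"
  using endo_hom[OF h_endo] .

lemma h_one: "on_curve A B P \<Longrightarrow> h (scal 1) P = P"
  using iso unfolding clf_end_iso_def end_one_def by simp

lemma h_add: "on_curve A B P \<Longrightarrow> h (q + r) P = padd A (h q P) (h r P)"
proof -
  have "h (q_add q r) = end_add A B (h q) (h r)" using iso unfolding clf_end_iso_def by blast
  then show "on_curve A B P \<Longrightarrow> ?thesis" by (simp only: end_add_def q_add_plus if_True)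
qed

lemma h_mult: "h (clf_mul F q r) P = h q (h r P)"
proof -
  have "h (clf_mul F q r) = h q \<circ> h r" using iso unfolding clf_end_iso_def by blast
  then show ?thesis by (simp only: comp_apply)
qed

lemma h_zero: "h 0 P = Inf"
proof (cases "on_curve A B P")
  case True
  then have "h 0 P = padd A (h 0 P) (h 0 P)" using h_add[of P 0 0] by simp
  then show ?thesis using padd_self_eq by metis
qed (rule h_off)

lemma h_uminus:
  assumes "on_curve A B P" shows "h (- q) P = pneg (h q P)"
  using h_add[OF assms, of q "- q"] by (simp add: h_zero padd_eq_Inf_iff flip: padd_eq_Inf_iff[of A])

lemma h_diff: "on_curve A B P \<Longrightarrow> h (q - r) P = padd A (h q P) (pneg (h r P))"
  using h_add[of P q "- r"] h_uminus by simp

lemma h_eqI: "(\<And>P. on_curve A B P \<Longrightarrow> h q P = h r P) \<Longrightarrow> q = r"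
proof (rule h_inj, rule ext)
  fix P assume "\<And>P. on_curve A B P \<Longrightarrow> h q P = h r P"
  then show "h q P = h r P" using h_off[of P q] h_off[of P r] by (cases "on_curve A B P") simp_all
qed

lemma h_rep: "\<exists>f g. rep (h q) f g"
  using endo_rep[OF h_endo] .

lemma rep_one: "rep (h (scal 1)) [:0, 1:] 1"
  using rep_cong[OF rep_id, of "h (scal 1)"] h_one by blast

lemma rep_two: "rep (h (scal 1 + scal 1)) dbl_num dbl_den"
  by (rule rep_cong[OF rep_dbl]) (simp only: h_add h_one simp_thms)

lemma h_rep_triple:
  assumes "rep (h q) f1 g1" "rep (h r) f2 g2" "rep (h (q + r)) f3 g3" "rep (h (q - r)) f4 g4"
  shows "\<exists>c. c \<noteq> 0 \<and> g3 * g4 = smult c (triple_den f1 g1 f2 g2) \<and>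
    f3 * g4 + f4 * g3 = smult c (triple_sum [:A:] [:B:] f1 g1 f2 g2) \<and>
    f3 * f4 = smult c (triple_prod [:A:] [:B:] f1 g1 f2 g2)"
  by (rule rep_triple[OF assms]) (use h_on h_add h_diff in auto)

text \<open>Tripling comes from 2 + 1 and 2 - 1 = 1: the product of numerators has degree 2 * (4 +
  1) = 10, of which the factor x belongs to 2 - 1. The denominator is a constant times the square of
  a polynomial of degree at most 4.\<close>

lemma rep_three:
  assumes r: "rep (h (scal 1 + scal 1 + scal 1)) f g"
  shows "degree f = 9" "degree g < 9"
proof -
  have tops: "has_top dbl_num 4 1" "has_top dbl_den 4 0" "has_top [:0, 1 :: 'k:] 1 1" "has_top (1 :: 'k poly) 1 0"
    by (auto simp: has_top_def degree_dbl coeff_eq_0) (simp add: dbl_num_def numeral_eq_Suc)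
  have "rep (h (scal 1 + scal 1 - scal 1)) [:0, 1:] 1"
    unfolding add_diff_cancel_right' by (rule rep_one)
  from h_rep_triple[OF rep_two rep_one r this] obtain c where c: "c \<noteq> 0"
    and g: "g * 1 = smult c (triple_den dbl_num dbl_den [:0, 1:] 1)"
    and f: "f * [:0, 1:] = smult c (triple_prod [:A:] [:B:] dbl_num dbl_den [:0, 1:] 1)"
    by blast
  have "has_top (f * [:0, 1:]) 10 (c * 1)"
    unfolding f by (rule has_top_cong[OF has_top_smult[OF triple_prod_top[OF tops]]]) (auto simp: triple_prod_def)
  then have d: "degree (f * [:0, 1:]) = 10" by (rule has_top_degree) (use c in simp)
  then have "f \<noteq> 0" by auto
  then have "degree (f * [:0, 1:]) = degree f + degree [:0, 1 :: 'k:]" by (intro degree_mult_eq) auto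
  then show "degree f = 9" using d by simp
  have "degree (dbl_num * 1 - [:0, 1:] * dbl_den) \<le> 4"
    by (intro degree_diff_le) (auto simp: degree_dbl degree_mult_eq intro!: order_trans[OF degree_pCons_le])
  then have "degree ((dbl_num * 1 - [:0, 1:] * dbl_den) ^ 2) \<le> 2 * 4"
    using coeff_power_le_degree by blast
  then show "degree g < 9" using g c by (simp add: triple_den_def)
qed

text \<open>An isogeny fixes the point at infinity.  If \<open>q\<close> sent it to \<open>(a : b)\<close>, then so would \<open>2 q\<close> and
  \<open>3 q\<close>, being \<open>q\<close> after a map fixing infinity; the relation for \<open>2 q + q\<close> and \<open>2 q - q\<close> then
  gives \<open>b = 0\<close>.\<close>

lemma rep_infinity:
  assumes r: "rep (h q) f g"
  shows "degree g \<le> degree f \<and> coeff g (degree f) = 0"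
proof -
  define n where "n = max (degree f) (degree g)"
  have nz: "f \<noteq> 0 \<or> g \<noteq> 0" using rep_nz[OF r, of 0] by auto
  have n: "degree f \<le> n" "degree g \<le> n" by (simp_all add: n_def)
  moreover have "coeff f n \<noteq> 0 \<or> coeff g n \<noteq> 0"
  proof (cases "degree f < degree g \<or> f = 0")
    case True
    then have "n = degree g" "g \<noteq> 0" using nz by (auto simp: n_def)
    then show ?thesis by simp
  next
    case False
    then have "n = degree f" "f \<noteq> 0" by (auto simp: n_def)
    then show ?thesis by simp
  qed
  ultimately have n: "degree f \<le> n" "degree g \<le> n" "coeff f n \<noteq> 0 \<or> coeff g n \<noteq> 0" by auto
  obtain f3 g3 where r3: "rep (h (scal 1 + scal 1 + scal 1)) f3 g3" using h_rep by blast
  note d3 = rep_three[OF r3]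
  define l where "l = coeff f3 9"
  have l: "l \<noteq> 0" using d3 leading_coeff_0_iff[of f3] by (auto simp: l_def simp del: leading_coeff_0_iff)
  have top3: "has_top f3 9 l" "has_top g3 9 0" using d3 by (auto simp: has_top_def l_def coeff_eq_0)
  have top2: "has_top dbl_num 4 1" "has_top dbl_den 4 0"
    by (auto simp: has_top_def degree_dbl coeff_eq_0) (simp add: dbl_num_def numeral_eq_Suc)
  have rq2: "rep (h (q + q)) (hcomp n f dbl_num dbl_den) (hcomp n g dbl_num dbl_den)"
  proof (rule rep_cong[OF rep_comp[OF r rep_two h_on n]])
    show "h (q + q) (Pt x y) = h q (h (scal 1 + scal 1) (Pt x y)) \<or>
        h (q + q) (Pt x y) = pneg (h q (h (scal 1 + scal 1) (Pt x y)))"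
      if "on_curve A B (Pt x y)" for x y
      using that by (simp only: h_add h_one h_hom simp_thms)
  qed (simp_all add: degree_dbl)
  have rq3: "rep (h (q + q + q)) (hcomp n f f3 g3) (hcomp n g f3 g3)"
  proof (rule rep_cong[OF rep_comp[OF r r3 h_on n]])
    show "h (q + q + q) (Pt x y) = h q (h (scal 1 + scal 1 + scal 1) (Pt x y)) \<or>
        h (q + q + q) (Pt x y) = pneg (h q (h (scal 1 + scal 1 + scal 1) (Pt x y)))"
      if "on_curve A B (Pt x y)" for x y
      using that padd_on_curve[OF that that] by (simp only: h_add h_one h_hom simp_thms)
  qed (simp_all add: d3)
  have "rep (h (q + q - q)) f g" using r by simp
  \<comment> \<open>The sum and difference of \<open>q\<close> with itself would give only 0 = 0
    here, because \<open>q - q\<close> has denominator zero; hence the pair \<open>q + q\<close> and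
    \<open>q\<close>.\<close>
  from h_rep_triple[OF rq2 r rq3 this] obtain c where
    c: "hcomp n g f3 g3 * g = smult c (triple_den (hcomp n f dbl_num dbl_den) (hcomp n g dbl_num dbl_den) f g)"
    by blast
  have topq: "has_top f n (coeff f n)" "has_top g n (coeff g n)" using n by (auto simp: has_top_def)
  have "has_top (hcomp n g f3 g3 * g) (n * 9 + n) (heval n g l 0 * coeff g n)"
    by (intro has_top_mult has_top_hcomp topq top3)
  \<comment> \<open>Both bounds equal \<open>10 * n\<close>. On this side the coefficient cancels,
    as \<open>q + q\<close> and \<open>q\<close> have the same value at infinity; on the other it is
    \<open>l ^ n * (coeff g n) ^ 2\<close>.\<close>
  moreover have "has_top (hcomp n g f3 g3 * g) (2 * (n * 4 + n))
      (c * (heval n f 1 0 * coeff g n - coeff f n * heval n g 1 0) ^ 2)"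
    unfolding c by (intro has_top_smult triple_den_top has_top_hcomp topq top2)
  ultimately have "coeff g n = 0" using l by (auto simp: has_top_def heval_zero_right)
  then have "degree f = n" using n by (simp add: le_antisym le_degree)
  then show ?thesis using n \<open>coeff g n = 0\<close> by simp
qed

text \<open>The numerator alone carries the degree of the rational function because infinity is
  fixed; the choice is harmless by \<open>rep_unique\<close>. The zero endomorphism has the pair
  \<open>(1, 0)\<close> and degree 0.\<close>

definition deg :: "q4 \<Rightarrow> nat" where
  "deg q = degree (SOME f. \<exists>g. rep (h q) f g)"

lemma deg_eq:
  assumes "rep (h q) f g" shows "deg q = degree f"
proof -
  define f' where "f' = (SOME f. \<exists>g. rep (h q) f g)"
  obtain g' where "rep (h q) f' g'" using someI_ex[OF h_rep[of q]] unfolding f'_def by blast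
  then have "degree f' = degree f" using rep_unique[OF _ assms] by fastforce
  then show ?thesis by (simp add: deg_def f'_def)
qed

lemma deg_rep:
  obtains f g where "rep (h q) f g" "deg q = degree f" "has_top f (deg q) (lead_coeff f)" "has_top g (deg q) 0" "f \<noteq> 0"
proof -
  obtain f g where r: "rep (h q) f g" using h_rep by blast
  note i = rep_infinity[OF r]
  have "f \<noteq> 0" using i rep_nz[OF r, of 0] degree_eq_zeroE[of g] by (metis coeff_0_degree_minus_1 degree_0 leading_coeff_0_iff le_zero_eq poly_0)
  then show ?thesis using that[OF r] i deg_eq[OF r] by (simp add: has_top_def)
qed

text \<open>Only the product of the numerators of \<open>q + r\<close> and \<open>q - r\<close> is
  needed: at infinity \<open>triple_prod\<close> reduces to the square of the product of the two
  leading coefficients, so its degree is exactly \<open>2 * (deg q + deg r)\<close>.\<close>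

lemma deg_parallelogram: "deg (q + r) + deg (q - r) = 2 * deg q + 2 * deg r"
proof -
  obtain f1 g1 where 1: "rep (h q) f1 g1" "deg q = degree f1" "has_top f1 (deg q) (lead_coeff f1)" "has_top g1 (deg q) 0" "f1 \<noteq> 0"
    by (rule deg_rep)
  obtain f2 g2 where 2: "rep (h r) f2 g2" "deg r = degree f2" "has_top f2 (deg r) (lead_coeff f2)" "has_top g2 (deg r) 0" "f2 \<noteq> 0"
    by (rule deg_rep)
  obtain f3 g3 where 3: "rep (h (q + r)) f3 g3" "deg (q + r) = degree f3" "f3 \<noteq> 0"
    by (rule deg_rep)
  obtain f4 g4 where 4: "rep (h (q - r)) f4 g4" "deg (q - r) = degree f4" "f4 \<noteq> 0"
    by (rule deg_rep)
  obtain c where c: "c \<noteq> 0" "f3 * f4 = smult c (triple_prod [:A:] [:B:] f1 g1 f2 g2)"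
    using h_rep_triple[OF 1(1) 2(1) 3(1) 4(1)] by blast
  have "has_top (f3 * f4) (2 * (deg q + deg r)) (c * triple_prod A B (lead_coeff f1) 0 (lead_coeff f2) 0)"
    unfolding c(2) by (intro has_top_smult triple_prod_top 1(3,4) 2(3,4))
  moreover have "c * triple_prod A B (lead_coeff f1) 0 (lead_coeff f2) 0 \<noteq> 0"
    using c 1(5) 2(5) by (simp add: triple_prod_def)
  ultimately have "degree (f3 * f4) = 2 * (deg q + deg r)" using has_top_degree by blast
  then show ?thesis using 3(2,3) 4(2,3) by (simp add: degree_mult_eq)
qed

lemma deg_one: "deg (scal 1) = 1"
  using deg_eq[OF rep_one] by simp

lemma deg_zero: "deg 0 = 0"
  using deg_parallelogram[of 0 0] by simp

lemma deg_eq_0_D: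
  assumes "deg q = 0" shows "q = 0"
proof -
  obtain f g where r: "rep (h q) f g" "deg q = degree f" "has_top g (deg q) 0" by (rule deg_rep)
  then have "g = 0" using assms unfolding has_top_def by (metis degree_eq_zeroE coeff_pCons_0 le_zero_eq pCons_0_0)
  then have "h q P = Inf" for P using endo_zero[OF h_endo] r(1) by blast
  then show ?thesis using h_zero by (intro h_inj) (auto simp: fun_eq_iff)
qed

text \<open>The homogenised composition has top coefficient
  \<open>lead_coeff f1 * lead_coeff f2 ^ deg q\<close>, which is nonzero. A constant inner map is
  outside the scope of \<open>rep_comp\<close>; it occurs only for \<open>r = 0\<close>.\<close>

lemma deg_mult: "deg (clf_mul F q r) = deg q * deg r"
proof (cases "deg r = 0")
  case True
  then have "r = 0" by (rule deg_eq_0_D)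
  then have "h (clf_mul F q r) P = h 0 P" for P
    using h_mult[of q r P] endo_Inf[OF h_endo] by (simp add: h_zero)
  then have "clf_mul F q r = 0" by (intro h_inj) (auto simp: fun_eq_iff)
  then show ?thesis using True deg_zero by simp
next
  case False
  obtain f1 g1 where 1: "rep (h q) f1 g1" "deg q = degree f1" "has_top f1 (deg q) (lead_coeff f1)" "has_top g1 (deg q) 0" "f1 \<noteq> 0"
    by (rule deg_rep)
  obtain f2 g2 where 2: "rep (h r) f2 g2" "deg r = degree f2" "has_top f2 (deg r) (lead_coeff f2)" "has_top g2 (deg r) 0" "f2 \<noteq> 0"
    by (rule deg_rep)
  have "rep (\<lambda>P. h q (h r P)) (hcomp (deg q) f1 f2 g2) (hcomp (deg q) g1 f2 g2)"
    by (rule rep_comp[OF 1(1) 2(1) h_on]) (use 1 2 False in \<open>auto simp: has_top_def\<close>)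
  then have "rep (h (clf_mul F q r)) (hcomp (deg q) f1 f2 g2) (hcomp (deg q) g1 f2 g2)"
    by (rule rep_cong) (simp add: h_mult)
  then have "deg (clf_mul F q r) = degree (hcomp (deg q) f1 f2 g2)" by (rule deg_eq)
  moreover have "has_top (hcomp (deg q) f1 f2 g2) (deg q * deg r) (heval (deg q) f1 (lead_coeff f2) 0)"
    by (intro has_top_hcomp 2)
  then have "degree (hcomp (deg q) f1 f2 g2) = deg q * deg r"
    using 1 2 by (intro has_top_degree) (auto simp: heval_zero_right)
  ultimately show ?thesis by simp
qed

lemma deg_quadratic:
  "int (deg (scal m + q_smul l q)) =
     m ^ 2 + m * l * (int (deg (scal 1 + q)) - 1 - int (deg q)) + l ^ 2 * int (deg q)"
proof -
  define D where "D m l = int (deg (scal m + q_smul l q))" for m l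
  have lin: "q_smul (l + l') q = q_smul l q + q_smul l' q" "q_smul (l - l') q = q_smul l q - q_smul l' q"
     "q_smul 0 q = 0" "q_smul 1 q = q" for l l'
    by (cases q; simp add: algebra_simps zero_prod_def)+
  have "D (m + m') (l + l') + D (m - m') (l - l') = 2 * D m l + 2 * D m' l'" for m l m' l'
  proof -
    have "scal (m + m') + q_smul (l + l') q = (scal m + q_smul l q) + (scal m' + q_smul l' q)"
      "scal (m - m') + q_smul (l - l') q = (scal m + q_smul l q) - (scal m' + q_smul l' q)"
      by (cases q; simp add: algebra_simps)+
    then show ?thesis
      using deg_parallelogram[of "scal m + q_smul l q" "scal m' + q_smul l' q"] unfolding D_def by simp
  qed
  from parallelogram_imp_quadratic[of D m l, OF this]
  show ?thesis using deg_one by (simp add: D_def lin flip: zero_prod_def)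
qed

lemma deg_scal: "int (deg (scal m)) = m ^ 2"
  using deg_quadratic[of m 0 0] by (simp add: zero_prod_def)

text \<open>Equal x-coordinate maps make \<open>triple_den\<close> vanish identically, so
  \<open>q + r\<close> or \<open>q - r\<close> has denominator zero and is the zero endomorphism.
  The sign is thus the same at all points.\<close>

lemma rep_eq_imp_eq_or_uminus:
  assumes "rep (h q) f g" "rep (h r) f g"
  shows "q = r \<or> q = - r"
proof -
  obtain f3 g3 f4 g4 where s: "rep (h (q + r)) f3 g3" "rep (h (q - r)) f4 g4" using h_rep by blast
  have "g3 * g4 = 0" using h_rep_triple[OF assms s] by (auto simp: triple_den_def)
  then have "deg (q + r) = 0 \<or> deg (q - r) = 0"
  proof (rule disjE[OF mult_eq_0_iff[THEN iffD1]])
    have *: "degree f = 0" if "rep (h q) f 0" for q f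
      using rep_nz[OF that] alg_closed_imp_poly_has_root[of f] by auto
    show "g3 = 0 \<Longrightarrow> ?thesis" using * s deg_eq by metis
    show "g4 = 0 \<Longrightarrow> ?thesis" using * s deg_eq by metis
  qed
  then show ?thesis using deg_eq_0_D by (metis add_eq_0_iff2 eq_iff_diff_eq_0)
qed

end

section \<open>Trace and norm in the even Clifford order\<close>

lemma clf_mul_explicit:
  "clf_mul (a, b, c, u, v, w) (t1, x1, y1, z1) (t2, x2, y2, z2) =
    (t1 * t2 - b * c * x1 * x2 - a * c * y1 * y2 - a * b * z1 * z2 + a * u * y1 * z2 + b * v * z1 * x2
       + c * w * x1 * y2 - v * w * z1 * y2 - u * w * x1 * z2 - u * v * y1 * x2,
     t1 * x2 + x1 * t2 + u * x1 * x2 - a * y1 * z2 + a * z1 * y2 + w * x1 * z2 + v * y1 * x2,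
     t1 * y2 + y1 * t2 + v * y1 * y2 - b * z1 * x2 + w * z1 * y2 + b * x1 * z2 + u * y1 * x2,
     t1 * z2 + z1 * t2 + w * z1 * z2 - c * x1 * y2 + v * z1 * y2 + u * x1 * z2 + c * y1 * x2)"
  by (simp add: clf_mul_def algebra_simps)

fun clf_trace :: "tform \<Rightarrow> q4 \<Rightarrow> int" where
  "clf_trace (a, b, c, u, v, w) (t, x, y, z) = 2 * t + u * x + v * y + w * z"

fun clf_norm :: "tform \<Rightarrow> q4 \<Rightarrow> int" where
  "clf_norm (a, b, c, u, v, w) (t, x, y, z) =
     t ^ 2 + t * (u * x + v * y + w * z) + b * c * x ^ 2 + a * c * y ^ 2 + a * b * z ^ 2
     + (u * v - c * w) * x * y + (u * w - b * v) * x * z + (v * w - a * u) * y * z"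

lemma clf_mul_conj: "clf_mul F q (scal (clf_trace F q) - q) = scal (clf_norm F q)"
  by (cases F; cases q) (simp add: clf_mul_explicit algebra_simps power2_eq_square)

text \<open>This product and the next two are put in the shape \<open>scal m + q_smul l q\<close>,
  on which \<open>deg_quadratic\<close> evaluates the degree.\<close>

lemma clf_mul_self: "clf_mul F q q = scal (- clf_norm F q) + q_smul (clf_trace F q) q"
  by (cases F; cases q) (simp add: clf_mul_explicit algebra_simps power2_eq_square)

lemma clf_mul_one_plus:
  "clf_mul F q (scal 1 + q) = scal (- clf_norm F q) + q_smul (clf_trace F q + 1) q"
  by (cases F; cases q) (simp add: clf_mul_explicit algebra_simps power2_eq_square)

lemma clf_mul_one_plus_minus:
  "clf_mul F (scal 1 + q) (scal 1 - q) = scal (1 + clf_norm F q) + q_smul (- clf_trace F q) q"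
  by (cases F; cases q) (simp add: clf_mul_explicit algebra_simps power2_eq_square)

lemma clf_mul_one_add_left: "clf_mul F (scal 1 + s) q = q + clf_mul F s q"
  by (cases F; cases q; cases s) (simp add: clf_mul_explicit algebra_simps)

lemma clf_mul_one_diff_left: "clf_mul F (scal 1 - s) q = q - clf_mul F s q"
  by (cases F; cases q; cases s) (simp add: clf_mul_explicit algebra_simps)

text \<open>Multiplication by the central odd element of the full Clifford algebra, whose square is
  minus the discriminant, embeds the lattice of the form into the even part.\<close>

lemma properly_represents_two_imp:
  assumes "properly_represents F 2"
  shows "\<exists>q. clf_mul F q q = scal (- form_disc F)"
proof -
  obtain a b c u v w where F: "F = (a, b, c, u, v, w)" by (cases F)
  obtain x y z where "form_eval F x y z = 2" using assms unfolding properly_represents_def by blast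
  then have Q: "a * x ^ 2 + b * y ^ 2 + c * z ^ 2 + u * y * z + v * x * z + w * x * y = 1"
    unfolding F by simp
  \<comment> \<open>The vector part is the symmetric matrix of F applied to
    \<open>(x, y, z)\<close>; the scalar part is then the one that makes the trace zero.\<close>
  define q where "q = (- ((a * u + v * w) * x + (b * v + u * w) * y + (c * w + u * v) * z),
    2 * a * x + w * y + v * z, w * x + 2 * b * y + u * z, v * x + u * y + 2 * c * z)"
  have "clf_trace F q = 0"
    unfolding F q_def by (simp add: algebra_simps)
  moreover have "clf_norm F q = form_disc F *
      (a * x ^ 2 + b * y ^ 2 + c * z ^ 2 + u * y * z + v * x * z + w * x * y)"
    unfolding F q_def by (simp add: algebra_simps power2_eq_square)
  ultimately have "clf_mul F q q = scal (- form_disc F)"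
    using clf_mul_self[of F q] Q by (cases q) simp
  then show ?thesis by blast
qed

text \<open>Inverts the preceding construction: the matrix of F has determinant
  \<open>2 * p\<close>, so its inverse is the adjoint divided by \<open>2 * p\<close>, and the point
  is to show that this quotient is integral on the vector part of \<open>q\<close>.\<close>

lemma properly_represents_two_if:
  assumes p: "prime p" "p > 2" and disc: "form_disc F = int p"
    and tr: "clf_trace F q = 0" and nm: "clf_norm F q = int p"
  shows "properly_represents F 2"
proof -
  obtain a b c u v w where F: "F = (a, b, c, u, v, w)" by (cases F)
  obtain t x y z where q: "q = (t, x, y, z)" by (cases q)
  have d: "4 * a * b * c + u * v * w - a * u ^ 2 - b * v ^ 2 - c * w ^ 2 = int p"
    using disc by (simp add: F)
  have t: "u * x + v * y + w * z = - 2 * t" using tr by (simp add: F q)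
  define X where "X = (4 * b * c - u ^ 2) * x + (u * v - 2 * c * w) * y + (u * w - 2 * b * v) * z"
  define Y where "Y = (u * v - 2 * c * w) * x + (4 * a * c - v ^ 2) * y + (v * w - 2 * a * u) * z"
  define Z where "Z = (u * w - 2 * b * v) * x + (v * w - 2 * a * u) * y + (4 * a * b - w ^ 2) * z"
  \<comment> \<open>The adjoint form at the vector part is four times the norm, once the trace is
    zero.\<close>
  have s: "x * X + y * Y + z * Z = 4 * int p"
    using t nm unfolding F q X_def Y_def Z_def by (simp, algebra)
  \<comment> \<open>The 2 by 2 minors of an adjoint matrix are the determinant times entries of the
    original matrix, so modulo the determinant the adjoint behaves like a matrix of rank one.
    Together with \<open>s\<close> this makes the squares divisible by \<open>p\<close>.\<close>
  have sq: "X ^ 2 = (4 * b * c - u ^ 2) * (x * X + y * Y + z * Z) - 2 * int p * (2 * c * y ^ 2 - 2 * u * y * z + 2 * b * z ^ 2)"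
    "Y ^ 2 = (4 * a * c - v ^ 2) * (x * X + y * Y + z * Z) - 2 * int p * (2 * c * x ^ 2 - 2 * v * x * z + 2 * a * z ^ 2)"
    "Z ^ 2 = (4 * a * b - w ^ 2) * (x * X + y * Y + z * Z) - 2 * int p * (2 * b * x ^ 2 - 2 * w * x * y + 2 * a * y ^ 2)"
    unfolding X_def Y_def Z_def d[symmetric] by algebra+
  have ip: "prime (int p)" using p by simp
  have "int p dvd X ^ 2" "int p dvd Y ^ 2" "int p dvd Z ^ 2"
    unfolding sq s by (auto intro!: dvd_diff)
  then have pd: "int p dvd X" "int p dvd Y" "int p dvd Z"
    using ip prime_dvd_power by blast+
  have "X = 2 * (2 * b * c * x - c * w * y - b * v * z + u * t + u * (v * y + w * z))
     \<and> Y = 2 * (2 * a * c * y - c * w * x - a * u * z + v * t + v * (u * x + w * z))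
     \<and> Z = 2 * (2 * a * b * z - b * v * x - a * u * y + w * t + w * (u * x + v * y))"
    using t unfolding X_def Y_def Z_def by algebra
  then have "2 dvd X" "2 dvd Y" "2 dvd Z" by simp_all
  moreover have "coprime (2 :: int) (int p)"
    using p prime_odd_nat[of p] by simp
  ultimately have "2 * int p dvd X" "2 * int p dvd Y" "2 * int p dvd Z"
    using pd by (simp_all add: divides_mult)
  then obtain X' Y' Z' where XYZ: "X = 2 * int p * X'" "Y = 2 * int p * Y'" "Z = 2 * int p * Z'"
    unfolding dvd_def by blast
  have M: "2 * a * X + w * Y + v * Z = 2 * int p * x" "w * X + 2 * b * Y + u * Z = 2 * int p * y"
    "v * X + u * Y + 2 * c * Z = 2 * int p * z"
    unfolding X_def Y_def Z_def d[symmetric] by algebra+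
  have "form_eval F X Y Z = X * (2 * a * X + w * Y + v * Z) + Y * (w * X + 2 * b * Y + u * Z)
      + Z * (v * X + u * Y + 2 * c * Z)"
    unfolding F by (simp, algebra)
  also have "\<dots> = 2 * int p * (x * X + y * Y + z * Z)" unfolding M by algebra
  also have "\<dots> = (2 * int p) ^ 2 * 2" unfolding s by algebra
  finally have "(2 * int p) ^ 2 * form_eval F X' Y' Z' = (2 * int p) ^ 2 * 2"
    unfolding XYZ F by (simp add: algebra_simps power2_eq_square)
  then have e: "form_eval F X' Y' Z' = 2" using p by simp
  define g where "g = gcd (gcd X' Y') Z'"
  have "g dvd X'" "g dvd Y'" "g dvd Z'"
    unfolding g_def by (meson gcd_dvd1 gcd_dvd2 dvd_trans)+
  then obtain k l m where k: "X' = g * k" "Y' = g * l" "Z' = g * m" unfolding dvd_def by blast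
  \<comment> \<open>A common factor \<open>g\<close> enters the even value 2 as
    \<open>2 * g ^ 2\<close>, which forces \<open>g ^ 2\<close> to divide 1.\<close>
  have "2 = 2 * (g ^ 2 * (a * k ^ 2 + b * l ^ 2 + c * m ^ 2 + u * l * m + v * k * m + w * k * l))"
    using e unfolding F k by (simp add: algebra_simps power2_eq_square)
  then have "g ^ 2 dvd 1" by (metis dvd_triv_left mult_cancel_left2 zero_neq_numeral)
  then have "g dvd 1" by (rule dvd_trans[rotated]) (simp add: power2_eq_square)
  then have "g = 1" using gcd_ge_0_int[of "gcd X' Y'" Z'] by (auto simp: g_def)
  then show ?thesis using e unfolding properly_represents_def g_def by (intro exI conjI)
qed

section \<open>Integer equations for norm and trace\<close>

lemma prime_mult_square_eq_square:
  fixes p x t :: int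
  assumes "prime p" "x ^ 2 = t ^ 2 * p"
  shows "t = 0"
proof (rule ccontr)
  assume t: "t \<noteq> 0"
  then have x: "x \<noteq> 0" using assms by auto
  have "multiplicity p (x ^ 2) = 2 * multiplicity p x"
    by (rule prime_elem_multiplicity_power_distrib) (use assms(1) x in auto)
  moreover have "multiplicity p (t ^ 2 * p) = 2 * multiplicity p t + 1"
    using assms t by (subst prime_elem_multiplicity_mult_distrib)
      (auto simp: prime_elem_multiplicity_power_distrib multiplicity_self prime_gt_0_int)
  ultimately have "2 * multiplicity p x = 2 * multiplicity p t + 1"
    by (simp only: assms(2))
  then show False by presburger
qed

text \<open>The hypotheses evaluate the degrees of q q, q (1 + q) and (1 + q)(1 - q) in two ways,
  where \<open>b\<close> is the middle coefficient of the degree form on Z + Z q. The first two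
  leave the spurious case \<open>N = - p\<close>, \<open>T = 0\<close>, where q^2 would be
  \<open>p\<close>; the third one turns it into \<open>b ^ 2 = 4 * p\<close>, impossible for a
  prime.\<close>

lemma norm_trace_of_degrees:
  fixes p N T b :: int
  assumes p: "prime p"
    and 1: "p * p = N ^ 2 - N * T * b + T ^ 2 * p"
    and 2: "p * (1 + b + p) = N ^ 2 - N * (T + 1) * b + (T + 1) ^ 2 * p"
    and 3: "(1 + b + p) * (1 - b + p) = (1 + N) ^ 2 - (1 + N) * T * b + T ^ 2 * p"
  shows "N = p \<and> T = b"
proof -
  have pos: "p > 0" using p by (simp add: prime_gt_0_int)
  have e: "(p + N) * b = 2 * T * p" using 1 2 by algebra
  have "(N - p) * ((N + p) ^ 2 - T ^ 2 * p) = 0" using 1 e by algebra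
  moreover have "(N + p) ^ 2 \<noteq> T ^ 2 * p"
  proof
    assume *: "(N + p) ^ 2 = T ^ 2 * p"
    then have T: "T = 0" using prime_mult_square_eq_square[OF p] by blast
    then have "N = - p" using * by simp
    then have "b ^ 2 = 2 ^ 2 * p" using 3 T by algebra
    then show False using prime_mult_square_eq_square[OF p] by fastforce
  qed
  ultimately have "N = p" by simp
  then show ?thesis using e pos by simp
qed

section \<open>Twisted Frobenius endomorphisms\<close>

text \<open>Covers \<open>n = 1\<close> and \<open>n = p\<close> at once, so that automorphisms and
  Frobenius maps share their proofs. For odd \<open>n\<close>, \<open>y ^ n\<close> is
  \<open>y\<close> times a polynomial in \<open>x\<close> on the curve, the shape required of an
  endomorphism.\<close>

definition additive_power :: "'k::field itself \<Rightarrow> nat \<Rightarrow> bool" where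
  "additive_power _ n \<longleftrightarrow> odd n \<and> (\<forall>x y :: 'k. (x + y) ^ n = x ^ n + y ^ n)"

lemma additive_power_one: "additive_power TYPE('k::field) 1"
  by (simp add: additive_power_def)

lemma additive_power_CHAR:
  assumes "prime CHAR('k::field)" "CHAR('k) > 2"
  shows "additive_power TYPE('k) CHAR('k)"
  unfolding additive_power_def using freshmans_dream[where 'a = 'k] assms prime_odd_nat by blast

context
  fixes n :: nat
  assumes add: "additive_power TYPE('k::field) n"
begin

lemma n_pos: "n > 0"
  using add unfolding additive_power_def by (cases n) auto

lemma pow_add: "(x + y :: 'k) ^ n = x ^ n + y ^ n"
  using add unfolding additive_power_def by blast

lemma pow_minus: "(- x :: 'k) ^ n = - (x ^ n)"
  using add unfolding additive_power_def by simp

lemma pow_diff: "(x - y :: 'k) ^ n = x ^ n - y ^ n"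
  using pow_add[of x "- y"] by (simp add: pow_minus)

lemma pow_inj: "(x :: 'k) ^ n = y ^ n \<longleftrightarrow> x = y"
  using pow_diff[of x y] n_pos by (metis eq_iff_diff_eq_0 power_eq_0_iff)

lemma pow_of_nat: "(of_nat m :: 'k) ^ n = of_nat m"
  by (induction m) (use n_pos in \<open>auto simp: pow_add\<close>)

lemma pow_numeral: "(numeral m :: 'k) ^ n = numeral m"
  using pow_of_nat[of "numeral m"] by simp

lemma pow_pow: "((x :: 'k) ^ k) ^ n = (x ^ n) ^ k"
  by (simp add: mult.commute flip: power_mult)

end

text \<open>The n-th power map goes to the curve with coefficients \<open>A ^ n\<close> and
  \<open>B ^ n\<close>; scaling by \<open>w ^ 2\<close> and \<open>w ^ 3\<close> returns to the
  original curve when \<open>w ^ 4 * A ^ n = A\<close> and \<open>w ^ 6 * B ^ n = B\<close>.\<close>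

definition frob_map :: "'k::field \<Rightarrow> 'k \<Rightarrow> 'k \<Rightarrow> nat \<Rightarrow> 'k point \<Rightarrow> 'k point" where
  "frob_map A B w n P = (if on_curve A B P then
     (case P of Inf \<Rightarrow> Inf | Pt x y \<Rightarrow> Pt (w ^ 2 * x ^ n) (w ^ 3 * y ^ n)) else Inf)"

context elliptic
begin

lemma frob_map_on:
  assumes add: "additive_power TYPE('k) n" and w: "w ^ 4 * A ^ n = A" "w ^ 6 * B ^ n = B"
    and P: "on_curve A B P"
  shows "on_curve A B (frob_map A B w n P)"
proof (cases P)
  case (Pt x y)
  note p = pow_add[OF add] pow_pow[OF add]
  have "(y ^ n) ^ 2 = (x ^ n) ^ 3 + A ^ n * x ^ n + B ^ n"
  proof -
    have "(y ^ n) ^ 2 = (x ^ 3 + A * x + B) ^ n" using P Pt by (simp flip: pow_pow[OF add])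
    then show ?thesis by (simp add: p power_mult_distrib)
  qed
  moreover have "(w ^ 3 * Y) ^ 2 = (w ^ 2 * X) ^ 3 + A * (w ^ 2 * X) + B"
    if "Y ^ 2 = X ^ 3 + A' * X + B'" "w ^ 4 * A' = A" "w ^ 6 * B' = B" for X Y A' B'
    using that(1) unfolding that(2,3)[symmetric] by algebra
  ultimately have "(w ^ 3 * y ^ n) ^ 2 = (w ^ 2 * x ^ n) ^ 3 + A * (w ^ 2 * x ^ n) + B"
    using w by blast
  then show ?thesis using P Pt by (simp add: frob_map_def)
qed (simp add: frob_map_def)

lemma frob_map_padd:
  assumes add: "additive_power TYPE('k) n" and w: "w ^ 4 * A ^ n = A" "w ^ 6 * B ^ n = B" and w0: "w \<noteq> 0"
    and P: "on_curve A B P" and Q: "on_curve A B Q"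
  shows "frob_map A B w n (padd A P Q) = padd A (frob_map A B w n P) (frob_map A B w n Q)"
proof (cases P; cases Q)
  fix x1 y1 x2 y2 assume PQ: "P = Pt x1 y1" "Q = Pt x2 y2"
  note inj = pow_inj[OF add]
  note p = pow_add[OF add] pow_diff[OF add] pow_pow[OF add] pow_numeral[OF add] power_mult_distrib power_divide
  have x: "w ^ 2 * x1 ^ n = w ^ 2 * x2 ^ n \<longleftrightarrow> x1 = x2" using w0 inj by simp
  have y: "w ^ 3 * y1 ^ n = - (w ^ 3 * y2 ^ n) \<longleftrightarrow> y1 = - y2"
    using w0 inj[of y1 "- y2"] pow_minus[OF add, of y2] by (metis mult_minus_right mult_left_cancel power_not_zero)
  have S: "on_curve A B (padd A P Q)" using padd_on_curve[OF P Q] .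
  have fP: "frob_map A B w n P = Pt (w ^ 2 * x1 ^ n) (w ^ 3 * y1 ^ n)"
    and fQ: "frob_map A B w n Q = Pt (w ^ 2 * x2 ^ n) (w ^ 3 * y2 ^ n)"
    using P Q by (simp_all add: PQ frob_map_def)
  show ?thesis
  proof (cases "x1 = x2 \<and> y1 = - y2")
    case True
    then show ?thesis unfolding fP fQ using x y by (simp add: PQ frob_map_def)
  next
    case False
    define l where "l = (if x1 = x2 then (3 * x1 ^ 2 + A) / (2 * y1) else (y2 - y1) / (x2 - x1))"
    define l' where "l' = (if x1 = x2 then (3 * (w ^ 2 * x1 ^ n) ^ 2 + A) / (2 * (w ^ 3 * y1 ^ n))
       else (w ^ 3 * y2 ^ n - w ^ 3 * y1 ^ n) / (w ^ 2 * x2 ^ n - w ^ 2 * x1 ^ n))"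
    have S': "padd A P Q = Pt (l ^ 2 - x1 - x2) (l * (x1 - (l ^ 2 - x1 - x2)) - y1)"
      using False by (simp add: PQ Let_def l_def)
    \<comment> \<open>Slopes have weight 3 - 2 = 1, hence a single factor \<open>w\<close>.\<close>
    have l': "l' = w * l ^ n"
    proof (cases "x1 = x2")
      case True
      then have "y1 ^ 2 = y2 ^ 2" using P Q PQ by simp
      then have y12: "y1 = y2" using False True by (auto simp: power2_eq_iff)
      have "y1 \<noteq> 0" using False True y12 by auto
      then have nz: "2 * (w ^ 3 * y1 ^ n) \<noteq> 0" "2 * y1 ^ n \<noteq> 0" using two_nz w0 by simp_all
      have "l ^ n = (3 * (x1 ^ n) ^ 2 + A ^ n) / (2 * y1 ^ n)" using True by (simp add: l_def p)
      then have e: "l ^ n * (2 * y1 ^ n) = 3 * (x1 ^ n) ^ 2 + A ^ n" using nz(2) by simp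
      have "w * L * (2 * (w ^ 3 * Y)) = 3 * (w ^ 2 * X) ^ 2 + A"
        if "L * (2 * Y) = 3 * X ^ 2 + A'" "w ^ 4 * A' = A" for L X Y A'
        using that(1) unfolding that(2)[symmetric] by algebra
      from this[OF e w(1)] have "w * l ^ n * (2 * (w ^ 3 * y1 ^ n)) = 3 * (w ^ 2 * x1 ^ n) ^ 2 + A" .
      then show ?thesis using True nz(1) by (simp add: l'_def divide_eq_eq del: mult_eq_0_iff)
    next
      case False
      then have nz: "x2 ^ n - x1 ^ n \<noteq> 0" using inj by (metis eq_iff_diff_eq_0)
      have "l ^ n = (y2 ^ n - y1 ^ n) / (x2 ^ n - x1 ^ n)" using False by (simp add: l_def p)
      then have e: "l ^ n * (x2 ^ n - x1 ^ n) = y2 ^ n - y1 ^ n" using nz by simp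
      have "w * L * (w ^ 2 * X2 - w ^ 2 * X1) = w ^ 3 * Y2 - w ^ 3 * Y1"
        if "L * (X2 - X1) = Y2 - Y1" for L X1 X2 Y1 Y2
        using that by algebra
      from this[OF e] have "w * l ^ n * (w ^ 2 * x2 ^ n - w ^ 2 * x1 ^ n) = w ^ 3 * y2 ^ n - w ^ 3 * y1 ^ n" .
      moreover have "w ^ 2 * x2 ^ n - w ^ 2 * x1 ^ n \<noteq> 0"
        using nz w0 by (simp flip: right_diff_distrib)
      ultimately show ?thesis using False by (simp add: l'_def divide_eq_eq)
    qed
    have "padd A (frob_map A B w n P) (frob_map A B w n Q) =
       Pt (l' ^ 2 - w ^ 2 * x1 ^ n - w ^ 2 * x2 ^ n)
         (l' * (w ^ 2 * x1 ^ n - (l' ^ 2 - w ^ 2 * x1 ^ n - w ^ 2 * x2 ^ n)) - w ^ 3 * y1 ^ n)"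
      unfolding fP fQ using False x y by (simp add: Let_def l'_def)
    also have "\<dots> = Pt (w ^ 2 * (l ^ 2 - x1 - x2) ^ n) (w ^ 3 * (l * (x1 - (l ^ 2 - x1 - x2)) - y1) ^ n)"
      unfolding l' by (simp add: p algebra_simps power2_eq_square power3_eq_cube)
    also have "\<dots> = frob_map A B w n (padd A P Q)"
      using S unfolding S' by (simp add: frob_map_def)
    finally show ?thesis by simp
  qed
qed (use P Q in \<open>auto simp: frob_map_def\<close>)

lemma frob_map_endo:
  assumes add: "additive_power TYPE('k) n" and w: "w ^ 4 * A ^ n = A" "w ^ 6 * B ^ n = B" and w0: "w \<noteq> 0"
  shows "is_endo A B (frob_map A B w n)"
proof -
  obtain k where k: "n = Suc (2 * k)" using add unfolding additive_power_def by (metis oddE Suc_eq_plus1)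
  have y: "w ^ 3 * y ^ n = w ^ 3 * (x ^ 3 + A * x + B) ^ k * y" if "on_curve A B (Pt x y)" for x y
  proof -
    have "y ^ n = (y ^ 2) ^ k * y" by (simp add: k power_mult)
    then show ?thesis using that by simp
  qed
  have "poly (monom (w ^ 2) n) x = w ^ 2 * x ^ n" for x by (simp add: poly_monom)
  moreover have "poly (smult (w ^ 3) ([:B, A, 0, 1:] ^ k)) x = w ^ 3 * (x ^ 3 + A * x + B) ^ k" for x
  proof -
    have "poly [:B, A, 0, 1:] x = x ^ 3 + A * x + B" by (simp add: algebra_simps power3_eq_cube)
    then show ?thesis by (simp only: poly_smult poly_power)
  qed
  ultimately have "{(x, y). on_curve A B (Pt x y) \<and> \<not> (poly 1 x \<noteq> 0 \<and> poly 1 x \<noteq> 0 \<and>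
      frob_map A B w n (Pt x y) = Pt ((poly (monom (w ^ 2) n) x + poly 0 x * y) / poly 1 x)
         ((poly 0 x + poly (smult (w ^ 3) ([:B, A, 0, 1:] ^ k)) x * y) / poly 1 x))} = {}"
    using y by (auto simp: frob_map_def simp del: poly_smult poly_power)
  then have fin: "finite {(x, y). on_curve A B (Pt x y) \<and> \<not> (poly 1 x \<noteq> 0 \<and> poly 1 x \<noteq> 0 \<and>
      frob_map A B w n (Pt x y) = Pt ((poly (monom (w ^ 2) n) x + poly 0 x * y) / poly 1 x)
         ((poly 0 x + poly (smult (w ^ 3) ([:B, A, 0, 1:] ^ k)) x * y) / poly 1 x))}"
    by (simp only: finite.emptyI)
  show ?thesis
    unfolding is_endo_def
  proof (intro conjI allI impI disjI2)
    show "\<exists>a1 b1 c1 a2 b2 c2. c1 \<noteq> 0 \<and> c2 \<noteq> 0 \<and> finite {(x, y). on_curve A B (Pt x y) \<and>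
              \<not> (poly c1 x \<noteq> 0 \<and> poly c2 x \<noteq> 0 \<and>
                 frob_map A B w n (Pt x y) = Pt ((poly a1 x + poly b1 x * y) / poly c1 x)
                                  ((poly a2 x + poly b2 x * y) / poly c2 x))}"
      by (rule exI, rule exI, rule exI, rule exI, rule exI, rule exI, rule conjI[OF _ conjI[OF _ fin]]) simp_all
  qed (use frob_map_on[OF add w] frob_map_padd[OF add w w0] in \<open>auto simp: frob_map_def\<close>)
qed

lemma frob_map_rep: "rep (frob_map A B w n) (monom (w ^ 2) n) 1"
  unfolding rep_def by (auto intro!: generic_True simp: frob_map_def poly_monom)

text \<open>Two twisted Frobenius maps with the same \<open>n\<close> differ by the automorphism
  with parameter \<open>c / w\<close>.\<close>

lemma frob_map_scale:
  assumes add: "additive_power TYPE('k) n" and w: "w ^ 4 * A ^ n = A" "w ^ 6 * B ^ n = B" and w0: "w \<noteq> 0"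
    and P: "on_curve A B P"
  shows "frob_map A B (c / w) 1 (frob_map A B w n P) = frob_map A B c n P"
  using frob_map_on[OF add w P] P w0 unfolding frob_map_def
  by (cases P) (simp_all add: power_divide)

section \<open>The j-invariant and isomorphism with the Frobenius twist\<close>

lemma cubic_three_roots:
  obtains e1 e2 e3 where "e1 ^ 3 + A * e1 + B = 0" "e2 ^ 3 + A * e2 + B = 0" "e3 ^ 3 + A * e3 + B = 0"
    "e1 \<noteq> e2" "e1 \<noteq> e3" "e2 \<noteq> e3"
proof -
  obtain e1 where "poly [:B, A, 0, 1:] e1 = 0" using alg_closed_imp_poly_has_root[of "[:B, A, 0, 1:]"] by auto
  then have e1: "e1 ^ 3 + A * e1 + B = 0" by (simp add: algebra_simps power3_eq_cube)
  obtain e2 where "poly [:e1 ^ 2 + A, e1, 1:] e2 = 0"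
    using alg_closed_imp_poly_has_root[of "[:e1 ^ 2 + A, e1, 1:]"] by auto
  then have e2: "e2 ^ 2 + e1 * e2 + e1 ^ 2 + A = 0" by (simp add: algebra_simps power2_eq_square)
  have r2: "e2 ^ 3 + A * e2 + B = 0" using e1 e2 by algebra
  have r3: "(- e1 - e2) ^ 3 + A * (- e1 - e2) + B = 0" using e1 e2 by algebra
  have "e1 \<noteq> e2" using cubic_roots_simple[OF e1] e2 by (auto simp: algebra_simps power2_eq_square)
  moreover have "e1 \<noteq> - e1 - e2"
  proof
    assume "e1 = - e1 - e2"
    then have "3 * e1 ^ 2 + A = 0" using e2 by algebra
    then show False using cubic_roots_simple[OF e1] by simp
  qed
  moreover have "e2 \<noteq> - e1 - e2"
  proof
    assume "e2 = - e1 - e2"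
    then have "3 * e2 ^ 2 + A = 0" using e2 by algebra
    then show False using cubic_roots_simple[OF r2] by simp
  qed
  ultimately show ?thesis using that e1 r2 r3 by blast
qed

lemma frobenius_affine_on_roots:
  assumes add: "additive_power TYPE('k) n" and a: "a \<noteq> 0"
    and r: "\<And>e. e ^ 3 + A * e + B = 0 \<Longrightarrow> (a * e ^ n + b) ^ 3 + A * (a * e ^ n + b) + B = 0"
  shows "b = 0 \<and> a ^ 2 * A ^ n = A \<and> a ^ 3 * B ^ n = B"
proof -
  note p = pow_add[OF add] pow_pow[OF add] power_mult_distrib
  \<comment> \<open>The cubic at \<open>a * z + b\<close> minus \<open>a ^ 3\<close> times the cubic
    with coefficients \<open>A ^ n\<close>, \<open>B ^ n\<close>. The terms in \<open>z ^ 3\<close>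
    cancel, so the three distinct roots \<open>e ^ n\<close> force \<open>G = 0\<close>; its
    coefficients are the claims, the quadratic one giving \<open>b = 0\<close> as 3 is
    invertible.\<close>
  define G where "G = [:b ^ 3 + A * b + B - a ^ 3 * B ^ n, 3 * a * b ^ 2 + a * A - a ^ 3 * A ^ n, 3 * a ^ 2 * b:]"
  have G: "poly G (e ^ n) = 0" if e: "e ^ 3 + A * e + B = 0" for e
  proof -
    have "(e ^ n) ^ 3 + A ^ n * e ^ n + B ^ n = (e ^ 3 + A * e + B) ^ n" by (simp add: p)
    also have "\<dots> = 0" using e n_pos[OF add] by simp
    finally have "(e ^ n) ^ 3 + A ^ n * e ^ n + B ^ n = 0" .
    moreover have "poly G (e ^ n) = (a * e ^ n + b) ^ 3 + A * (a * e ^ n + b) + B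
       - a ^ 3 * ((e ^ n) ^ 3 + A ^ n * e ^ n + B ^ n)"
      unfolding G_def by (simp, algebra)
    ultimately show ?thesis using r[OF e] by simp
  qed
  obtain e1 e2 e3 where e: "e1 ^ 3 + A * e1 + B = 0" "e2 ^ 3 + A * e2 + B = 0" "e3 ^ 3 + A * e3 + B = 0"
    "e1 \<noteq> e2" "e1 \<noteq> e3" "e2 \<noteq> e3" by (rule cubic_three_roots)
  have "G = 0"
  proof (rule ccontr)
    assume nz: "G \<noteq> 0"
    have "{e1 ^ n, e2 ^ n, e3 ^ n} \<subseteq> {x. poly G x = 0}" using G e by blast
    then have "card {e1 ^ n, e2 ^ n, e3 ^ n} \<le> card {x. poly G x = 0}"
      by (intro card_mono poly_roots_finite nz)
    moreover have "card {e1 ^ n, e2 ^ n, e3 ^ n} = 3" using e(4-6) by (simp add: pow_inj[OF add])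
    moreover have "degree G \<le> 2" by (simp add: G_def)
    ultimately show False using card_poly_roots_bound[OF nz] by linarith
  qed
  then have g: "3 * a ^ 2 * b = 0" "3 * a * b ^ 2 + a * A - a ^ 3 * A ^ n = 0" "b ^ 3 + A * b + B - a ^ 3 * B ^ n = 0"
    unfolding G_def by (simp_all only: pCons_eq_0_iff)
  then have b: "b = 0" using a three_nz by simp
  then have "a * (a ^ 2 * A ^ n) = a * A" "a ^ 3 * B ^ n = B" using g by (auto simp: power3_eq_cube power2_eq_square mult.assoc)
  then show ?thesis using a b by simp
qed

text \<open>The twist with coefficients \<open>A ^ n\<close>, \<open>B ^ n\<close> has j-invariant
  \<open>j_inv A B ^ n\<close>, and equal j-invariants mean an isomorphism by scaling
  coordinates.\<close>

lemma j_inv_fixed_iff: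
  assumes add: "additive_power TYPE('k) n"
  shows "j_inv A B ^ n = j_inv A B \<longleftrightarrow> (\<exists>w. w \<noteq> 0 \<and> w ^ 4 * A ^ n = A \<and> w ^ 6 * B ^ n = B)"
proof -
  note p = pow_add[OF add] pow_pow[OF add] pow_numeral[OF add] power_mult_distrib power_divide
  define A' B' where "A' = A ^ n" and "B' = B ^ n"
  have A0: "A' = 0 \<longleftrightarrow> A = 0" and B0: "B' = 0 \<longleftrightarrow> B = 0" using n_pos[OF add] by (auto simp: A'_def B'_def)
  have "4 * A' ^ 3 + 27 * B' ^ 2 = (4 * A ^ 3 + 27 * B ^ 2) ^ n"
    by (simp add: p A'_def B'_def)
  then have nz': "4 * A' ^ 3 + 27 * B' ^ 2 \<noteq> 0" using nonsing by simp
  have j': "j_inv A B ^ n = 1728 * (4 * A' ^ 3) / (4 * A' ^ 3 + 27 * B' ^ 2)"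
    unfolding j_inv_def by (simp add: p A'_def B'_def)
  show ?thesis
  proof
    assume "j_inv A B ^ n = j_inv A B"
    then have "1728 * (4 * A' ^ 3) * (4 * A ^ 3 + 27 * B ^ 2) = 1728 * (4 * A ^ 3) * (4 * A' ^ 3 + 27 * B' ^ 2)"
      unfolding j' unfolding j_inv_def using nonsing nz' by (simp add: frac_eq_eq)
    \<comment> \<open>The constant is 1728 * 4 * 27, invertible because 2 and 3 are.\<close>
    then have "2 ^ 8 * 3 ^ 6 * (A' ^ 3 * B ^ 2 - A ^ 3 * B' ^ 2) = 0" by algebra
    then have e: "A' ^ 3 * B ^ 2 = A ^ 3 * B' ^ 2"
      using two_nz three_nz by (simp only: mult_eq_0_iff power_eq_0_iff) auto
    have "\<exists>w. w ^ 4 * A' = A \<and> w ^ 6 * B' = B"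
    \<comment> \<open>If one coefficient vanishes, its condition is empty and a single fourth or
      sixth root suffices; otherwise \<open>w ^ 2\<close> must be the quotient of the prescribed
      \<open>w ^ 6\<close> and \<open>w ^ 4\<close>.\<close>
    proof (cases "A = 0 \<or> B = 0")
      case True
      obtain w1 w2 where "w1 ^ 6 = B / B'" "w2 ^ 4 = A / A'"
        using nth_root_exists[of 6 "B / B'"] nth_root_exists[of 4 "A / A'"] by auto
      then have "(w1 ^ 6 * B' = B \<or> B = 0) \<and> (w2 ^ 4 * A' = A \<or> A = 0)" using B0 A0 by auto
      then show ?thesis using True A0 B0 nonsing by auto
    next
      case False
      then have nz: "A' \<noteq> 0" "B' \<noteq> 0" using A0 B0 by auto
      define \<mu> \<nu> where "\<mu> = A / A'" and "\<nu> = B / B'"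
      have \<mu>: "A = \<mu> * A'" and \<nu>: "B = \<nu> * B'" using nz by (simp_all add: \<mu>_def \<nu>_def)
      have "\<mu> \<noteq> 0" using False \<mu> by auto
      have "A' ^ 3 * B' ^ 2 * (\<mu> ^ 3 - \<nu> ^ 2) = 0" using e unfolding \<mu> \<nu> by algebra
      then have \<mu>\<nu>: "\<mu> ^ 3 = \<nu> ^ 2" using nz by simp
      obtain w where "w ^ 2 = \<nu> / \<mu>" using nth_root_exists[of 2 "\<nu> / \<mu>"] by auto
      then have w: "w ^ 2 * \<mu> = \<nu>" using \<open>\<mu> \<noteq> 0\<close> by simp
      have "\<mu> ^ 2 * (w ^ 4 - \<mu>) = (w ^ 2 * \<mu>) ^ 2 - \<mu> ^ 3" by algebra
      then have "\<mu> ^ 2 * (w ^ 4 - \<mu>) = 0" unfolding w \<mu>\<nu> by simp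
      then have w4: "w ^ 4 = \<mu>" using \<open>\<mu> \<noteq> 0\<close> by simp
      have "w ^ 6 = w ^ 2 * w ^ 4" by algebra
      then have "w ^ 6 = \<nu>" unfolding w4 w .
      then show ?thesis using w4 \<mu> \<nu> by blast
    qed
    then obtain w where w: "w ^ 4 * A' = A" "w ^ 6 * B' = B" by blast
    then have "w \<noteq> 0" using nonsing by (intro notI) simp
    then show "\<exists>w. w \<noteq> 0 \<and> w ^ 4 * A ^ n = A \<and> w ^ 6 * B ^ n = B" using w unfolding A'_def B'_def by blast
  next
    assume "\<exists>w. w \<noteq> 0 \<and> w ^ 4 * A ^ n = A \<and> w ^ 6 * B ^ n = B"
    then obtain w where w: "w \<noteq> 0" "w ^ 4 * A' = A" "w ^ 6 * B' = B" unfolding A'_def B'_def by blast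
    have "j_inv A B = (w ^ 12 * (1728 * (4 * A' ^ 3))) / (w ^ 12 * (4 * A' ^ 3 + 27 * B' ^ 2))"
      unfolding j_inv_def w(2,3)[symmetric] by (simp add: algebra_simps flip: power_mult)
    also have "\<dots> = j_inv A B ^ n" unfolding j' using w(1) by simp
    finally show "j_inv A B ^ n = j_inv A B" by simp
  qed
qed

end

section \<open>Endomorphisms dividing p\<close>

context elliptic
begin

lemma rep_smult: "k \<noteq> 0 \<Longrightarrow> rep \<phi> f g \<Longrightarrow> rep \<phi> (smult k f) (smult k g)"
proof -
  have "has_x P a b \<Longrightarrow> has_x P (k * a) (k * b)" for P a b by (cases P) auto
  then show "k \<noteq> 0 \<Longrightarrow> rep \<phi> f g \<Longrightarrow> ?thesis"
    unfolding rep_def by (auto elim: generic_mono)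
qed

text \<open>If the Wronskian \<open>W\<close> were nonzero, a value \<open>c\<close> avoiding
  finitely many bad ones would have only simple preimages, at least two of them. Points above these
  have images equal up to sign, so the trivial kernel makes the points equal up to sign,
  contradicting distinct x-coordinates.\<close>

lemma injective_endo_wronskian_eq_0:
  assumes e: "is_endo A B \<phi>" and inj: "\<And>P. on_curve A B P \<Longrightarrow> \<phi> P = Inf \<Longrightarrow> P = Inf"
    and r: "rep \<phi> f g" and d: "degree f > 1" "degree g < degree f" "g \<noteq> 0"
  shows "pderiv f * g = f * pderiv g"
proof (rule ccontr)
  define W where "W = pderiv f * g - f * pderiv g"
  assume "\<not> ?thesis"
  then have W: "W \<noteq> 0" by (simp add: W_def)
  obtain X where X: "finite X"
    "\<And>x y. x \<notin> X \<Longrightarrow> on_curve A B (Pt x y) \<Longrightarrow> has_x (\<phi> (Pt x y)) (poly f x) (poly g x)"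
    using rep_generic[OF r] unfolding generic_def by blast
  define Y where "Y = X \<union> {x. poly W x = 0}"
  have "finite Y" using X(1) W by (simp add: Y_def poly_roots_finite)
  then obtain c where c: "c \<notin> (\<lambda>x. poly f x / poly g x) ` Y"
    using ex_new_if_finite[OF alg_closed_infinite finite_imageI] by metis
  define s where "s = f - smult c g"
  have "degree (smult c g) < degree f" using d(2) by (meson degree_smult_le le_less_trans)
  then have "degree (f + - smult c g) = degree f" by (intro degree_add_eq_left) simp
  then have ds: "degree s = degree f" by (simp add: s_def)
  have root: "poly f x = c * poly g x \<and> poly g x \<noteq> 0 \<and> x \<notin> X \<and> poly (pderiv s) x \<noteq> 0" if "poly s x = 0" for x
  proof -
    have f: "poly f x = c * poly g x" using that by (simp add: s_def)
    have g: "poly g x \<noteq> 0" using rep_nz[OF r, of x] f by auto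
    then have "c = poly f x / poly g x" using f by simp
    then have "x \<notin> Y" using c by blast
    \<comment> \<open>At a root of \<open>s\<close> one has \<open>f = c * g\<close>, so the
      derivative of \<open>s\<close> is nonzero wherever \<open>W\<close> is.\<close>
    moreover have "poly (pderiv s) x * poly g x = poly W x"
      unfolding s_def W_def using f by (simp add: pderiv_diff pderiv_smult algebra_simps)
    ultimately show ?thesis using f g unfolding Y_def by auto
  qed
  obtain x1 where x1: "poly s x1 = 0" using alg_closed_imp_poly_has_root[of s] ds d(1) by auto
  then obtain t where t: "s = [:- x1, 1:] * t" unfolding poly_eq_0_iff_dvd by (auto simp only: dvd_def)
  have "t \<noteq> 0" using t ds d(1) by auto
  then have "degree s = 1 + degree t" unfolding t by (subst degree_mult_eq) auto
  then obtain x2 where x2: "poly t x2 = 0" using alg_closed_imp_poly_has_root[of t] ds d(1) by auto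
  have "x1 \<noteq> x2"
  proof
    assume "x1 = x2"
    then have "poly (pderiv s) x1 = 0" using x2 unfolding t pderiv_mult by (simp add: pderiv_pCons)
    then show False using root[OF x1] by simp
  qed
  have s2: "poly s x2 = 0" using x2 by (simp add: t)
  obtain y1 y2 where P: "on_curve A B (Pt x1 y1)" "on_curve A B (Pt x2 y2)" using ex_on_curve by metis
  have "has_x (\<phi> (Pt x1 y1)) c 1"
    using X(2)[OF _ P(1)] root[OF x1] by (cases "\<phi> (Pt x1 y1)") auto
  moreover have "has_x (\<phi> (Pt x2 y2)) c 1"
    using X(2)[OF _ P(2)] root[OF s2] by (cases "\<phi> (Pt x2 y2)") auto
  ultimately have "\<phi> (Pt x1 y1) = \<phi> (Pt x2 y2) \<or> \<phi> (Pt x1 y1) = pneg (\<phi> (Pt x2 y2))"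
    using has_x_eqD[OF _ _ _ endo_on[OF e P(1)] endo_on[OF e P(2)]] by simp
  then have "\<phi> (padd A (Pt x1 y1) (pneg (Pt x2 y2))) = Inf \<or> \<phi> (padd A (Pt x1 y1) (Pt x2 y2)) = Inf"
    using endo_hom[OF e P(1)] endo_pneg[OF e P(2)] P(2) on_curve_pneg[of A B "Pt x2 y2"] padd_eq_Inf_iff pneg_pneg
    by metis
  then have "padd A (Pt x1 y1) (pneg (Pt x2 y2)) = Inf \<or> padd A (Pt x1 y1) (Pt x2 y2) = Inf"
    using inj padd_on_curve[OF P] padd_on_curve[OF P(1), of "pneg (Pt x2 y2)"] P(2) on_curve_pneg by metis
  then show False using \<open>x1 \<noteq> x2\<close> by (auto simp: padd_eq_Inf_iff simp del: padd.simps)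
qed

end

text \<open>By coprimality the equation makes \<open>f\<close> divide its own derivative, which has
  smaller degree unless it vanishes.\<close>

lemma pderiv_eq_0_of_wronskian:
  fixes f g :: "'a::alg_closed_field poly"
  assumes nz: "\<And>x. poly f x \<noteq> 0 \<or> poly g x \<noteq> 0" and eq: "pderiv f * g = f * pderiv g"
  shows "pderiv f = 0"
proof (rule ccontr)
  assume "pderiv f \<noteq> 0"
  obtain u v w where "u * f + v * g + w * 0 = 1" using poly_bezout_three[of f g 0] nz by auto
  then have uv: "u * f + v * g = 1" by simp
  have "pderiv f = pderiv f * (u * f + v * g)" unfolding uv by simp
  also have "\<dots> = f * (u * pderiv f) + v * (pderiv f * g)" by (simp add: algebra_simps)
  also have "\<dots> = f * (u * pderiv f + v * pderiv g)" unfolding eq by (simp add: algebra_simps)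
  finally have "f dvd pderiv f" by (rule dvdI)
  then have "degree f \<le> degree (pderiv f)" using \<open>pderiv f \<noteq> 0\<close> by (rule dvd_imp_degree_le)
  moreover have "degree (pderiv f) \<le> degree f - 1"
    by (rule degree_le) (auto simp: coeff_pderiv coeff_eq_0)
  ultimately have "degree f = 0" by linarith
  then show False using \<open>pderiv f \<noteq> 0\<close> by (metis degree_eq_zeroE pderiv_singleton)
qed

lemma pderiv_eq_0_coeff:
  fixes f :: "'a::field poly"
  assumes "pderiv f = 0" "\<not> CHAR('a) dvd i"
  shows "coeff f i = 0"
proof (cases i)
  case (Suc m)
  have "of_nat i * coeff f i = coeff (pderiv f) m" by (simp only: coeff_pderiv Suc)
  then show ?thesis using assms by (simp add: of_nat_eq_0_iff_char_dvd)
qed (use assms in simp)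

section \<open>The two implications for a supersingular curve\<close>

locale supersingular_clf = endo_clf A B F h for A B :: "'k::alg_closed_field" and F h +
  fixes p :: nat
  assumes prime_p: "prime p" and p_gt: "p > 3" and char_p: "CHAR('k) = p"
    and ss: "supersingular p A B" and disc: "form_disc F = int p"
begin

lemma add_p: "additive_power TYPE('k) p"
  using additive_power_CHAR[where 'k = 'k] prime_p p_gt char_p by simp

lemma h_scal_nat: "on_curve A B P \<Longrightarrow> h (scal (int n)) P = pmul A n P"
proof (induction n)
  case 0
  then show ?case using h_zero[of P] by (simp add: zero_prod_def)
next
  case (Suc n)
  have "scal (int (Suc n)) = scal 1 + scal (int n)" by simp
  then show ?case using Suc h_add[of P "scal 1" "scal (int n)"] h_one by (simp only: pmul.simps)
qed

text \<open>A point killed by \<open>q\<close> is killed by \<open>p\<close>; this is where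
  supersingularity enters.\<close>

lemma kernel_trivial:
  assumes m: "clf_mul F r q = scal (int p) \<or> clf_mul F r q = scal (- int p)"
    and P: "on_curve A B P" and z: "h q P = Inf"
  shows "P = Inf"
proof -
  have "h (clf_mul F r q) P = Inf" using z endo_Inf[OF h_endo] by (simp add: h_mult)
  moreover have "h (scal (- int p)) P = pneg (h (scal (int p)) P)"
    using h_uminus[OF P, of "scal (int p)"] by simp
  ultimately have "h (scal (int p)) P = Inf"
    using m by (metis pneg.simps(1) pneg_pneg)
  then have "pmul A p P = Inf" using h_scal_nat[OF P] by simp
  then show ?thesis using ss P unfolding supersingular_def by blast
qed

lemma degree_p_factor_of_p:
  assumes m: "clf_mul F r q = scal (int p) \<or> clf_mul F r q = scal (- int p)" and d: "deg q = p"
  shows "\<exists>a. a \<noteq> 0 \<and> rep (h q) (monom a p) 1 \<and> a ^ 2 * A ^ p = A \<and> a ^ 3 * B ^ p = B"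
proof -
  obtain f g where r: "rep (h q) f g" "deg q = degree f" "has_top g (deg q) 0" by (rule deg_rep)
  have df: "degree f = p" using r d by simp
  have dg: "degree g \<le> p" "coeff g p = 0" using r(3) d by (auto simp: has_top_def)
  have "g \<noteq> 0"
  proof
    assume "g = 0"
    then have "\<And>x. poly f x \<noteq> 0" using rep_nz[OF r(1)] by simp
    then show False using alg_closed_imp_poly_has_root[of f] df p_gt by auto
  qed
  then have "degree g < p" using dg by (metis leading_coeff_0_iff le_neq_implies_less)
  then have W: "pderiv f * g = f * pderiv g"
    using injective_endo_wronskian_eq_0[OF h_endo kernel_trivial[OF m] r(1)] df p_gt \<open>g \<noteq> 0\<close> by simp
  have f0: "pderiv f = 0"
    by (rule pderiv_eq_0_of_wronskian[OF rep_nz[OF r(1)] W])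
  have g0: "pderiv g = 0"
    by (rule pderiv_eq_0_of_wronskian[of g f]) (use rep_nz[OF r(1)] W in \<open>auto simp: mult_ac\<close>)
  \<comment> \<open>Vanishing derivative leaves only exponents divisible by \<open>p\<close>. Since
    \<open>g\<close> has degree below \<open>p\<close> and \<open>f\<close> has degree
    \<open>p\<close>, \<open>g\<close> is constant and \<open>f\<close> has only the terms of
    exponents \<open>p\<close> and 0.\<close>
  have "coeff g i = 0" if "i > 0" for i
  proof (cases "i < p")
    case True
    then have "\<not> p dvd i" using that by (auto dest: dvd_imp_le)
    then show ?thesis using pderiv_eq_0_coeff[OF g0] char_p by simp
  qed (use \<open>degree g < p\<close> in \<open>simp add: coeff_eq_0\<close>)
  then have "degree g = 0" by (metis \<open>g \<noteq> 0\<close> gr0I leading_coeff_0_iff)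
  then obtain k where k: "g = [:k:]" using degree_eq_zeroE by blast
  have "k \<noteq> 0" using k \<open>g \<noteq> 0\<close> by simp
  define a b where "a = coeff f p / k" and "b = coeff f 0 / k"
  have "a \<noteq> 0" using df p_gt \<open>k \<noteq> 0\<close> unfolding a_def by (metis degree_0 divide_eq_0_iff gr_implies_not0 leading_coeff_0_iff)
  have f: "smult (inverse k) f = monom a p + [:b:]"
  proof (rule poly_eqI)
    fix i
    consider "i = 0" | "i = p" | "i > p" | "0 < i" "i < p" by linarith
    then show "coeff (smult (inverse k) f) i = coeff (monom a p + [:b:]) i"
    proof cases
      case 4
      then have "\<not> p dvd i" by (auto dest: dvd_imp_le)
      then have "coeff f i = 0" using pderiv_eq_0_coeff[OF f0] char_p by simp
      then show ?thesis using 4 by (simp add: coeff_pCons split: nat.split)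
    qed (use p_gt df in \<open>auto simp: a_def b_def field_simps coeff_eq_0 coeff_pCons split: nat.split\<close>)
  qed
  have "smult (inverse k) g = 1" using k \<open>k \<noteq> 0\<close> by (simp add: one_pCons)
  then have rq: "rep (h q) (monom a p + [:b:]) 1"
    using rep_smult[OF _ r(1), of "inverse k"] f \<open>k \<noteq> 0\<close> by simp
  define u where "u = monom a p + [:b:]"
  have du: "degree u = p" unfolding u_def using \<open>a \<noteq> 0\<close> p_gt by (simp add: degree_add_eq_left degree_monom_eq)
  have rq: "rep (h q) u 1" using rq by (simp only: u_def)
  \<comment> \<open>Doubling before \<open>q\<close> and doubling after \<open>q\<close> give two
    pairs for the same map; the denominator of the first is \<open>dbl_den ^ p\<close>.\<close>
  have *: "rep (h (q + q)) (hcomp p u dbl_num dbl_den) (hcomp p 1 dbl_num dbl_den)"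
  proof (rule rep_cong[OF rep_comp[OF rq rep_two h_on]])
    show "h (q + q) (Pt x y) = h q (h (scal 1 + scal 1) (Pt x y)) \<or>
        h (q + q) (Pt x y) = pneg (h q (h (scal 1 + scal 1) (Pt x y)))"
      if "on_curve A B (Pt x y)" for x y
      using that by (simp only: h_add h_one h_hom simp_thms)
    have "u \<noteq> 0" using du p_gt by auto
    then show "coeff u p \<noteq> 0 \<or> coeff 1 p \<noteq> (0::'k)" using du by auto
  qed (use du p_gt in \<open>auto simp: degree_dbl\<close>)
  have **: "rep (h (q + q)) (hcomp 4 dbl_num u 1) (hcomp 4 dbl_den u 1)"
  proof (rule rep_cong[OF rep_comp[OF rep_dbl rq h_on]])
    show "h (q + q) (Pt x y) = padd A (h q (Pt x y)) (h q (Pt x y)) \<or>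
        h (q + q) (Pt x y) = pneg (padd A (h q (Pt x y)) (h q (Pt x y)))"
      if "on_curve A B (Pt x y)" for x y
      using that by (simp only: h_add simp_thms)
    show "coeff dbl_num 4 \<noteq> 0 \<or> coeff dbl_den 4 \<noteq> 0"
      by (simp add: dbl_num_def numeral_eq_Suc)
  qed (use du p_gt in \<open>auto simp: degree_dbl\<close>)
  obtain c where c: "c \<noteq> 0" "hcomp p 1 dbl_num dbl_den = smult c (hcomp 4 dbl_den u 1)"
    using rep_unique[OF * **] by blast
  \<comment> \<open>Comparing denominators at a root \<open>e\<close> of the cubic shows that
    \<open>u\<close> maps the x-coordinates of 2-torsion points to such x-coordinates.\<close>
  have "b = 0 \<and> a ^ 2 * A ^ p = A \<and> a ^ 3 * B ^ p = B"
  proof (rule frobenius_affine_on_roots[OF add_p \<open>a \<noteq> 0\<close>])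
    fix e assume "e ^ 3 + A * e + B = 0"
    then have "poly dbl_den e = 0" by (simp add: poly_dbl)
    then have "poly (hcomp p 1 dbl_num dbl_den) e = 0"
      using p_gt by (simp add: poly_hcomp heval_zero_right)
    then have "heval 4 dbl_den (poly u e) 1 = 0" using c by (simp add: poly_hcomp)
    then have "poly dbl_den (poly u e) = 0" using heval_mult[of dbl_den 4 "poly u e" 1] by (simp add: degree_dbl)
    then have "poly u e ^ 3 + A * poly u e + B = 0" using four_nz
      unfolding poly_dbl mult_eq_0_iff by blast
    then show "(a * e ^ p + b) ^ 3 + A * (a * e ^ p + b) + B = 0" by (simp add: u_def poly_monom)
  qed
  then show ?thesis using rq \<open>a \<noteq> 0\<close> by (auto simp: u_def)
qed

lemma j_inv_fixed_if_represents:
  assumes "properly_represents F 2"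
  shows "j_inv A B ^ p = j_inv A B"
proof -
  obtain q where q: "clf_mul F q q = scal (- int p)"
    using properly_represents_two_imp[OF assms] disc by auto
  have "int (deg q * deg q) = int p ^ 2" using deg_mult[of q q] deg_scal[of "- int p"] q by simp
  then have "deg q = p" by (simp only: of_nat_mult power2_eq_square flip: of_nat_power) (metis of_nat_eq_iff of_nat_mult power2_eq_iff_nonneg power2_eq_square zero_le)
  then obtain a where a: "a \<noteq> 0" "a ^ 2 * A ^ p = A" "a ^ 3 * B ^ p = B"
    using degree_p_factor_of_p[of q q] q by blast
  obtain w where w: "w ^ 2 = a" using nth_root_exists[of 2 a] by auto
  have "w ^ 4 = a ^ 2" "w ^ 6 = a ^ 3" unfolding w[symmetric] by (simp_all flip: power_mult)
  then have "w \<noteq> 0 \<and> w ^ 4 * A ^ p = A \<and> w ^ 6 * B ^ p = B" using a w by auto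
  then show ?thesis using j_inv_fixed_iff[OF add_p] by blast
qed

lemma represents_if_j_inv_fixed:
  assumes "j_inv A B ^ p = j_inv A B"
  shows "properly_represents F 2"
proof -
  obtain w where w: "w \<noteq> 0" "w ^ 4 * A ^ p = A" "w ^ 6 * B ^ p = B"
    using assms j_inv_fixed_iff[OF add_p] by blast
  obtain q where q: "frob_map A B w p = h q"
    using h_surj[OF frob_map_endo[OF add_p w(2,3,1)]] by blast
  have dq: "deg q = p"
    using deg_eq[of q] frob_map_rep[of w p] w(1) unfolding q by (simp add: degree_monom_eq)
  define T N b where "T = clf_trace F q" and "N = clf_norm F q" and "b = int (deg (scal 1 + q)) - 1 - int p"
  have quad: "int (deg (scal m + q_smul l q)) = m ^ 2 + m * l * b + l ^ 2 * int p" for m l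
    using deg_quadratic[of m l q] unfolding dq b_def .
  have sm: "q_smul 1 q = q" "scal 1 + q_smul (- 1) q = scal 1 - q" by (cases q; simp)+
  have d1: "int (deg (scal 1 + q)) = 1 + b + int p" using quad[of 1 1] by (simp add: sm)
  have d2: "int (deg (scal 1 - q)) = 1 - b + int p" using quad[of 1 "- 1"] unfolding sm by simp
  have dm: "int (deg r) * int (deg s) = int (deg (clf_mul F r s))" for r s using deg_mult[of r s] by simp
  have ip: "prime (int p)" using prime_p by simp
  have NT: "N = int p \<and> T = b"
  proof (rule norm_trace_of_degrees[OF ip])
    show "int p * int p = N ^ 2 - N * T * b + T ^ 2 * int p"
      using dm[of q q] unfolding clf_mul_self dq quad by (simp add: T_def N_def)
    show "int p * (1 + b + int p) = N ^ 2 - N * (T + 1) * b + (T + 1) ^ 2 * int p"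
      using dm[of q "scal 1 + q"] unfolding clf_mul_one_plus dq d1 quad by (simp add: T_def N_def)
    show "(1 + b + int p) * (1 - b + int p) = (1 + N) ^ 2 - (1 + N) * T * b + T ^ 2 * int p"
      using dm[of "scal 1 + q" "scal 1 - q"] unfolding clf_mul_one_plus_minus d1 d2 quad by (simp add: T_def N_def)
  qed
  have "T ^ 2 \<le> 4 * int p"
  proof -
    \<comment> \<open>The degree of \<open>2 * q - b\<close> is \<open>4 * p - b ^ 2\<close>, the
      discriminant bound of a nonnegative form.\<close>
    have "0 \<le> (- b) ^ 2 + (- b) * 2 * b + 2 ^ 2 * int p" unfolding quad[symmetric] by simp
    then show ?thesis using NT by (simp add: power2_eq_square)
  qed
  define q' where "q' = scal T - q"
  have qq': "clf_mul F q q' = scal (int p)" using clf_mul_conj[of F q] NT by (simp add: q'_def T_def N_def)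
  have "int p * int (deg q') = int p * int p"
    using dm[of q q'] unfolding qq' deg_scal dq by (simp add: power2_eq_square)
  then have "deg q' = p" using p_gt by simp
  then obtain a where a: "a \<noteq> 0" "rep (h q') (monom a p) 1" "a ^ 2 * A ^ p = A" "a ^ 3 * B ^ p = B"
    using degree_p_factor_of_p[of q q'] qq' by blast
  obtain c where c: "c ^ 2 = a" using nth_root_exists[of 2 a] by auto
  have "c ^ 4 = a ^ 2" "c ^ 6 = a ^ 3" unfolding c[symmetric] by (simp_all flip: power_mult)
  then have c46: "c ^ 4 * A ^ p = A" "c ^ 6 * B ^ p = B" using a by auto
  have "c \<noteq> 0" using a c by auto
  then obtain r where r: "frob_map A B c p = h r"
    using h_surj[OF frob_map_endo[OF add_p c46]] by blast
  have "rep (h r) (monom a p) 1" using frob_map_rep[of c p] unfolding r c .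
  then have q'r: "q' = r \<or> q' = - r" using rep_eq_imp_eq_or_uminus a(2) by blast
  \<comment> \<open>Both \<open>w\<close> and \<open>c\<close> bring the twist back to the curve, so
    \<open>c / w\<close> gives an automorphism \<open>s\<close>, and \<open>r\<close> is
    \<open>s\<close> after \<open>q\<close>.\<close>
  have "(c / w) ^ 4 * A ^ 1 = A" "(c / w) ^ 6 * B ^ 1 = B"
  proof -
    have "(c / w) ^ 4 * (w ^ 4 * A ^ p) = c ^ 4 * A ^ p" "(c / w) ^ 6 * (w ^ 6 * B ^ p) = c ^ 6 * B ^ p"
      using w(1) by (simp_all add: power_divide)
    then show "(c / w) ^ 4 * A ^ 1 = A" "(c / w) ^ 6 * B ^ 1 = B" unfolding c46 w(2,3) by simp_all
  qed
  then obtain s where s: "frob_map A B (c / w) 1 = h s"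
    using h_surj[OF frob_map_endo[OF additive_power_one]] \<open>c \<noteq> 0\<close> w(1) by (metis divide_eq_0_iff)
  have "h (clf_mul F s q) P = h r P" if "on_curve A B P" for P
    using frob_map_scale[OF add_p w(2,3,1) that, of c] unfolding s q r h_mult .
  then have sq: "clf_mul F s q = r" by (rule h_eqI)
  have "scal T = q + q'" by (simp add: q'_def)
  \<comment> \<open>The sign left open by x-coordinates is harmless: in either case the trace is a
    multiple of \<open>q\<close>, so its degree \<open>T ^ 2\<close> is divisible by
    \<open>p\<close>.\<close>
  then have "scal T = clf_mul F (scal 1 + s) q \<or> scal T = clf_mul F (scal 1 - s) q"
    using q'r unfolding clf_mul_one_add_left clf_mul_one_diff_left sq by auto
  then obtain s' where "scal T = clf_mul F s' q" by blast
  then have "T ^ 2 = int (deg s') * int p" using deg_scal[of T] deg_mult[of s' q] dq by simp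
  then have "int p dvd T ^ 2" by simp
  then have "int p dvd T" using ip prime_dvd_power by blast
  then obtain k where k: "T = int p * k" by blast
  \<comment> \<open>A nonzero multiple of \<open>p\<close> would give
    \<open>p ^ 2 \<le> T ^ 2 \<le> 4 * p\<close>; with \<open>p > 3\<close> only the composite value
    4 remains.\<close>
  have "T = 0"
  proof (rule ccontr)
    assume "T \<noteq> 0"
    then have "1 \<le> k ^ 2" using k by (simp add: int_one_le_iff_zero_less)
    then have "int p ^ 2 \<le> T ^ 2" unfolding k power_mult_distrib by (metis mult.right_neutral mult_left_mono zero_le_power2)
    then have "int p * int p \<le> 4 * int p" using \<open>T ^ 2 \<le> 4 * int p\<close> by (simp add: power2_eq_square)
    then have "p \<le> 4" using p_gt by simp
    then have "p = 4" using p_gt by simp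
    moreover have "\<not> prime (4 :: nat)" using prime_product[of 2 2] by auto
    ultimately show False using prime_p by simp
  qed
  then show ?thesis
    using properly_represents_two_if[OF prime_p _ disc, of q] p_gt NT by (simp add: T_def N_def)
qed

end

theorem mainTheorem4:
  fixes p :: nat and A B :: "'k::alg_closed_field" and F :: tform
  assumes "prime p" and "p > 3"
    and "CHAR('k) = p"
    and "\<forall>x::'k. \<exists>n>0. x ^ (p ^ n) = x"
    and "A ^ (p ^ 2) = A" and "B ^ (p ^ 2) = B"
    and "nonsingular A B"
    and "supersingular p A B"
    and "form_disc F = int p"
    and "\<exists>h. clf_end_iso F A B h"
  shows "j_inv A B ^ p = j_inv A B \<longleftrightarrow> properly_represents F 2"
proof -
  obtain h where h: "clf_end_iso F A B h" using assms(10) by blast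
  have nz: "(of_nat m :: 'k) \<noteq> 0" if "0 < m" "m < p" for m
    unfolding of_nat_eq_0_iff_char_dvd assms(3) using that by (auto dest: dvd_imp_le)
  have "(2 :: 'k) \<noteq> 0" "(3 :: 'k) \<noteq> 0" using nz[of 2] nz[of 3] assms(2) by simp_all
  then interpret supersingular_clf A B F h p
    using assms h by unfold_locales (auto simp: nonsingular_def)
  show ?thesis using j_inv_fixed_if_represents represents_if_j_inv_fixed by blast
qed

end
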